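(* Let $X$ be a real random variable, let $V(t)=E[\sin(tX)]$ be the imaginary part of its characteristic function, and let $K(x)=1-F(x)-F(-x)$ for $x>0$ be its tail difference function. Suppose that $V(t)$ is regularly varying at $0$ with index $k$, where $0<k<2$ and $k\ne 1$, and that $K(x)$ is monotonic for all sufficiently large $x$. Then $$K(x)\sim \frac{V(1/x)}{C(k)}\quad\text{as } x\to\infty,$$ where $C(k)=\Gamma(1-k)\sin\left(\tfrac{\pi}{2}k\right)$.
   Context: $F$ is the intermediate distribution function $F(x)=\tfrac12[P(X<x)+P(X\le x)]$. A function $V$ is regularly varying at $0$ with index $k$ if $V(\lambda t)/V(t)\to\lambda^{k}$ as $t\downarrow 0$ for every $\lambda>0$ (in particular $V$ is nonzero on some interval $(0,\delta)$). The notation $f\sim g$ means that the ratio $f/g$ tends to $1$ in the specified limit. $\Gamma$ is the gamma function, extended to negative non-integer arguments by $\Gamma(r+1)=r\Gamma(r)$. *)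

theory Defs
  imports "HOL-Probability.Probability" "HOL-Library.Landau_Symbols"
begin

definition intermediate_cdf :: "'a measure \<Rightarrow> ('a \<Rightarrow> real) \<Rightarrow> real \<Rightarrow> real" where
  "intermediate_cdf M X x =
     (measure M {\<omega> \<in> space M. X \<omega> < x} + measure M {\<omega> \<in> space M. X \<omega> \<le> x}) / 2"

definition tail_difference :: "'a measure \<Rightarrow> ('a \<Rightarrow> real) \<Rightarrow> real \<Rightarrow> real" where
  "tail_difference M X x = 1 - intermediate_cdf M X x - intermediate_cdf M X (- x)"

text \<open>The imaginary part of the characteristic function of \<open>X\<close>.\<close>

definition sine_transform :: "'a measure \<Rightarrow> ('a \<Rightarrow> real) \<Rightarrow> real \<Rightarrow> real" where
  "sine_transform M X t = (\<integral>\<omega>. sin (t * X \<omega>) \<partial>M)"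

text \<open>
  No separate non-vanishing condition is needed: since \<open>x / 0 = 0\<close>, the instance \<open>l = 1\<close>
  already forces \<open>V\<close> to be nonzero on some interval to the right of \<open>0\<close>.
\<close>

definition regularly_varying_at_0 :: "(real \<Rightarrow> real) \<Rightarrow> real \<Rightarrow> bool" where
  "regularly_varying_at_0 V k \<longleftrightarrow>
     (\<forall>l>0. ((\<lambda>t. V (l * t) / V t) \<longlongrightarrow> l powr k) (at_right 0))"

lemma regularly_varying_at_0_nonzero:
  assumes "regularly_varying_at_0 V k"
  shows "\<exists>d>0. \<forall>t. 0 < t \<and> t < d \<longrightarrow> V t \<noteq> 0"
proof -
  have "((\<lambda>t. V (1 * t) / V t) \<longlongrightarrow> 1 powr k) (at_right 0)"
    using assms unfolding regularly_varying_at_0_def by (metis zero_less_one)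
  then have "((\<lambda>t. V t / V t) \<longlongrightarrow> 1) (at_right 0)" by simp
  then have "eventually (\<lambda>t. V t / V t > 0) (at_right 0)"
    by (rule order_tendstoD) simp
  then have "eventually (\<lambda>t. V t \<noteq> 0) (at_right 0)"
    by (rule eventually_mono) auto
  then show ?thesis by (auto simp: eventually_at_right_field)
qed

definition eventually_monotonic :: "(real \<Rightarrow> real) \<Rightarrow> bool" where
  "eventually_monotonic f \<longleftrightarrow> (\<exists>a. mono_on {a..} f \<or> antimono_on {a..} f)"

end

theory Submission
  imports Defs "HOL-Real_Asymp.Real_Asymp"
begin

text \<open>
  Write \<open>V\<close> for the sine transform and \<open>K\<close> for the tail difference. Integrating a Fejer-type kernel
  twice gives the exact formula
  \<open>(\<integral>u\<in>{0..1}. (1 - u) * K (u * x)) = 2 / pi * (\<integral>s\<in>{0..}. V (s / x) * (1 - cos s) / s ^ 3)\<close>,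
  whose right-hand side converges absolutely for every index \<open>0 < k < 2\<close>. Potter bounds for \<open>V\<close> and
  dominated convergence show that it is asymptotic to a constant times \<open>V (1 / x)\<close>. Hence so is every
  second difference of the double integral of \<open>K\<close>, and monotonicity of \<open>K\<close> squeezes \<open>h\<^sup>2 * K x\<close>
  between two such second differences of step \<open>h\<close>; finally let \<open>h\<close> tend to \<open>0\<close>.
\<close>

section \<open>The integral of \<open>(1 - cos s) * s powr (k - 3)\<close>\<close>

text \<open>Direct inversion writes \<open>K\<close> as an integral of \<open>V\<close> against a
  cosine over \<open>s\<close>, which in general converges only conditionally, so limits cannot be
  taken under the integral sign. Averaging \<open>K\<close> once over \<open>[0, x]\<close> leaves
  the kernel \<open>sin s / s^2\<close>; against the limit \<open>s powr k\<close> this is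
  absolutely integrable at infinity only for \<open>k < 1\<close>. The second averaging improves the
  decay to \<open>s powr (k - 3)\<close>, while near \<open>0\<close> the integrand is of order
  \<open>s powr (k - 1)\<close>: exactly the range \<open>0 < k < 2\<close>. The price is that
  \<open>K\<close> has to be recovered from a double integral of size \<open>x powr (2 - k)\<close>.
  Differentiating this power twice brings in the factor \<open>(2 - k) * (1 - k)\<close>, and the
  kernel integral brings in \<open>1 / (Gamma (3 - k) * sin (pi / 2 * k))\<close>; since
  \<open>Gamma (3 - k) = (2 - k) * (1 - k) * Gamma (1 - k)\<close>, the product is
  \<open>1 / C(k)\<close>. At \<open>k = 1\<close> the factor vanishes and the argument would yield
  only that \<open>K\<close> is of smaller order than \<open>V\<close>. Neither \<open>V\<close> nor
  \<open>K\<close> has a prescribed sign; both are normalised by a factor \<open>1\<close> or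
  \<open>-1\<close> at the end.\<close>

lemma Gamma_reflection_real:
  fixes x :: real
  shows "Gamma x * Gamma (1 - x) = pi / sin (pi * x)"
proof -
  have "1 - complex_of_real x = complex_of_real (1 - x)"
    by simp
  with Gamma_reflection_complex[of "complex_of_real x"]
  have "complex_of_real (Gamma x * Gamma (1 - x)) = complex_of_real (pi / sin (pi * x))"
    by (simp only: Gamma_complex_of_real of_real_mult of_real_divide flip: sin_of_real)
  then show ?thesis by (simp only: of_real_eq_iff)
qed

text \<open>The substitution \<open>t = u^2 / (1 + u^2)\<close> turns twice this integral into the
  Beta integral with parameters \<open>1 - k/2\<close> and \<open>k/2\<close>, which the reflection
  formula evaluates.\<close>

lemma has_integral_powr_div_1_plus_square:
  fixes k :: real
  assumes k: "0 < k" "k < 2"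
  shows "((\<lambda>u. u powr (1 - k) / (1 + u\<^sup>2)) has_integral pi / (2 * sin (pi / 2 * k))) {0<..}"
proof -
  define f where "f = (\<lambda>t::real. t powr ((1 - k / 2) - 1) * (1 - t) powr (k / 2 - 1))"
  define g where "g = (\<lambda>u::real. u\<^sup>2 / (1 + u\<^sup>2))"
  define g' where "g' = (\<lambda>u::real. 2 * u / (1 + u\<^sup>2)\<^sup>2)"
  have pos: "0 < 1 + u\<^sup>2" for u :: real by (simp add: add_pos_nonneg)
  have img: "g ` {0<..} = {0<..<1}"
  proof
    show "g ` {0<..} \<subseteq> {0<..<1}" by (auto simp: g_def pos divide_simps)
    show "{0<..<1} \<subseteq> g ` {0<..}"
    proof
      fix t :: real assume t: "t \<in> {0<..<1}"
      then have "0 \<le> t / (1 - t)" by simp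
      then have "g (sqrt (t / (1 - t))) = t"
        unfolding g_def using t by (simp add: divide_simps)
      moreover have "sqrt (t / (1 - t)) \<in> {0<..}" using t by simp
      ultimately show "t \<in> g ` {0<..}" by (metis image_eqI)
    qed
  qed
  have inj: "inj_on g {0<..}"
  proof (rule inj_onI)
    fix x y :: real assume xy: "x \<in> {0<..}" "y \<in> {0<..}" "g x = g y"
    then have "x\<^sup>2 = y\<^sup>2" using pos[of x] pos[of y] unfolding g_def by (simp add: field_simps)
    then show "x = y" using xy by (simp add: power2_eq_iff)
  qed
  have der: "(g has_field_derivative g' u) (at u within {0<..})" for u
    unfolding g_def g'_def using pos[of u]
    by (auto intro!: derivative_eq_intros simp: power2_eq_square field_simps)
  have fint: "f absolutely_integrable_on {0<..<1}" and fval: "integral {0<..<1} f = Beta (1 - k/2) (k/2)"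
  proof -
    have *: "(f has_integral Beta (1 - k/2) (k/2)) {0..1}"
      unfolding f_def by (rule has_integral_Beta_real) (use k in auto)
    then have "(f has_integral Beta (1 - k/2) (k/2)) {0<..<1}"
      by (simp add: has_integral_Icc_iff_Ioo)
    then show "f absolutely_integrable_on {0<..<1}" "integral {0<..<1} f = Beta (1 - k/2) (k/2)"
      by (auto intro!: nonnegative_absolutely_integrable_1 simp: f_def has_integral_iff)
  qed
  have "(\<lambda>x. \<bar>g' x\<bar> * f (g x)) absolutely_integrable_on {0<..} \<and>
      integral {0<..} (\<lambda>x. \<bar>g' x\<bar> * f (g x)) = Beta (1 - k/2) (k/2)"
    using has_absolute_integral_change_of_variables_1'[OF _ der inj, of f "Beta (1 - k/2) (k/2)"]
      fint fval img by simp
  then have "((\<lambda>x. \<bar>g' x\<bar> * f (g x)) has_integral Beta (1 - k/2) (k/2)) {0<..}"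
    using absolutely_integrable_on_def has_integral_iff by blast
  moreover have "\<bar>g' u\<bar> * f (g u) = 2 * (u powr (1 - k) / (1 + u\<^sup>2))" if "u \<in> {0<..}" for u
  proof -
    have u: "0 < u" using that by simp
    have 1: "1 - g u = 1 / (1 + u\<^sup>2)" using pos[of u] by (simp add: g_def field_simps)
    have lu: "ln (u\<^sup>2) = 2 * ln u" using u by (simp add: ln_realpow)
    \<comment> \<open>With \<open>ln (g u) = 2 * ln u - ln (1 + u^2)\<close> and
      \<open>ln (1 - g u) = - ln (1 + u^2)\<close>, the multiples of \<open>ln (1 + u^2)\<close>
      that contain \<open>k\<close> cancel.\<close>
    have "f (g u) = exp ((- k / 2) * (2 * ln u - ln (1 + u\<^sup>2)) - (k / 2 - 1) * ln (1 + u\<^sup>2))"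
      unfolding f_def 1 using u pos[of u]
      by (simp add: g_def powr_def ln_div lu exp_add[symmetric] algebra_simps)
    also have "\<dots> = exp (ln (1 + u\<^sup>2) - k * ln u)" by (simp add: algebra_simps)
    also have "\<dots> = (1 + u\<^sup>2) * u powr (- k)"
      using u pos[of u] by (simp add: exp_diff powr_def exp_minus divide_simps)
    finally have f: "f (g u) = (1 + u\<^sup>2) * u powr (- k)" .
    have "u powr (1 - k) = u * u powr (- k)"
      using u powr_mult_base[of u "-k"] by simp
    then show ?thesis unfolding f using u pos[of u]
      by (simp add: g'_def power2_eq_square divide_simps)
  qed
  ultimately have "((\<lambda>u. 2 * (u powr (1 - k) / (1 + u\<^sup>2))) has_integral Beta (1 - k/2) (k/2)) {0<..}"
    by (rule has_integral_eq[rotated])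
  from has_integral_mult_right[OF this, of "1/2"]
  have "((\<lambda>u. u powr (1 - k) / (1 + u\<^sup>2)) has_integral Beta (1 - k/2) (k/2) / 2) {0<..}" by simp
  moreover have "Beta (1 - k/2) (k/2) = pi / sin (pi / 2 * k)"
    using Gamma_reflection_real[of "k/2"] by (simp add: Beta_def mult.commute)
  ultimately show ?thesis by (simp add: mult.commute)
qed

text \<open>This is the Laplace transform of \<open>1 - cos\<close>, namely
  \<open>1/u - u / (1 + u^2)\<close>, over a common denominator. The function \<open>F\<close> in
  the proof is the antiderivative that vanishes at infinity, so the value is
  \<open>- F 0\<close>.\<close>

lemma nn_integral_exp_times_1_minus_cos:
  fixes u :: real
  assumes u: "0 < u"
  shows "(\<integral>\<^sup>+s. ennreal ((1 - cos s) * exp (- (s * u))) * indicator {0..} s \<partial>lborel) = ennreal (1 / (u * (1 + u\<^sup>2)))"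
proof -
  define F where "F = (\<lambda>s. - exp (- (s * u)) / u - exp (- (s * u)) * (sin s - u * cos s) / (1 + u\<^sup>2))"
  have pos: "0 < 1 + u\<^sup>2" by (simp add: add_pos_nonneg)
  have lim0: "((\<lambda>s. exp (- (s * u))) \<longlongrightarrow> 0) at_top"
    using u by (auto intro!: exp_at_bot[THEN filterlim_compose] filterlim_tendsto_pos_mult_at_top filterlim_ident
             simp: filterlim_uminus_at_bot mult.commute[of _ u])
  have limF: "(F \<longlongrightarrow> 0) at_top"
  proof (rule Lim_null_comparison)
    show "\<forall>\<^sub>F s in at_top. norm (F s) \<le> exp (- (s * u)) * (1 / u + (1 + u) / (1 + u\<^sup>2))"
    proof (rule always_eventually, rule allI)
      fix s
      have b: "\<bar>sin s - u * cos s\<bar> \<le> 1 + u"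
      proof -
        have "\<bar>u * cos s\<bar> \<le> u * 1" unfolding abs_mult using u by (intro mult_mono) auto
        then show ?thesis using abs_sin_le_one[of s] by linarith
      qed
      have "F s = - exp (- (s * u)) * (1 / u + (sin s - u * cos s) / (1 + u\<^sup>2))"
        by (simp add: F_def divide_inverse algebra_simps)
      then have "norm (F s) = exp (- (s * u)) * \<bar>1 / u + (sin s - u * cos s) / (1 + u\<^sup>2)\<bar>"
        by (simp add: abs_mult)
      also have "\<bar>1 / u + (sin s - u * cos s) / (1 + u\<^sup>2)\<bar> \<le> \<bar>1/u\<bar> + \<bar>(sin s - u * cos s) / (1 + u\<^sup>2)\<bar>"
        by (rule abs_triangle_ineq)
      also have "\<dots> \<le> 1 / u + (1 + u) / (1 + u\<^sup>2)"
        using b u pos by (simp add: abs_divide divide_right_mono)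
      finally show "norm (F s) \<le> exp (- (s * u)) * (1 / u + (1 + u) / (1 + u\<^sup>2))"
        by (simp add: mult_left_mono)
    qed
    show "((\<lambda>s. exp (- (s * u)) * (1 / u + (1 + u) / (1 + u\<^sup>2))) \<longlongrightarrow> 0) at_top"
      using tendsto_mult_right[OF lim0, of "1 / u + (1 + u) / (1 + u\<^sup>2)"] by (simp add: mult.commute)
  qed
  have "(\<integral>\<^sup>+s. ennreal ((1 - cos s) * exp (- (s * u))) * indicator {0..} s \<partial>lborel) = ennreal (0 - F 0)"
  proof (rule nn_integral_FTC_atLeast[where F = F])
    fix s :: real
    have "(F has_real_derivative exp (- (s * u)) - (exp (- (s * u)) * (cos s + u * sin s) +
        (- u * exp (- (s * u))) * (sin s - u * cos s)) / (1 + u\<^sup>2)) (at s)"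
      unfolding F_def using u pos by (auto intro!: derivative_eq_intros simp: divide_simps) (simp add: algebra_simps)
    also have "exp (- (s * u)) - (exp (- (s * u)) * (cos s + u * sin s) +
        (- u * exp (- (s * u))) * (sin s - u * cos s)) / (1 + u\<^sup>2) = (1 - cos s) * exp (- (s * u))"
      using pos by (simp add: divide_simps) (simp add: algebra_simps power2_eq_square)
    finally show "(F has_real_derivative (1 - cos s) * exp (- (s * u))) (at s)" .
  qed (use limF in auto)
  also have "0 - F 0 = 1 / (u * (1 + u\<^sup>2))"
    using u pos by (simp add: F_def divide_simps) (simp add: algebra_simps power2_eq_square)
  finally show ?thesis .
qed

text \<open>Euler's Gamma integral rescaled by \<open>s\<close>. Read from right to left, it
  represents a negative power of \<open>s\<close> as a superposition of exponentials.\<close>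

lemma nn_integral_powr_times_exp:
  fixes p s :: real
  assumes "0 < p" "0 < s"
  shows "(\<integral>\<^sup>+u. ennreal (u powr (p - 1) * exp (- (s * u))) * indicator {0<..} u \<partial>lborel) = ennreal (Gamma p * s powr (- p))"
proof -
  have "ennreal (Gamma p) = (\<integral>\<^sup>+ t. ennreal (indicator {0..} t * t powr (p - 1) / exp t) \<partial>lborel)"
    by (rule Gamma_conv_nn_integral_real) fact
  also have "\<dots> = ennreal \<bar>s\<bar> * (\<integral>\<^sup>+ u. ennreal (indicator {0..} (0 + s * u) * (0 + s * u) powr (p - 1) / exp (0 + s * u)) \<partial>lborel)"
    by (rule nn_integral_real_affine) (use assms in auto)
  also have "(\<integral>\<^sup>+ u. ennreal (indicator {0..} (0 + s * u) * (0 + s * u) powr (p - 1) / exp (0 + s * u)) \<partial>lborel)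
     = (\<integral>\<^sup>+ u. ennreal (s powr (p - 1)) * (ennreal (u powr (p - 1) * exp (- (s * u))) * indicator {0<..} u) \<partial>lborel)"
    using assms
    by (intro nn_integral_cong_AE AE_I[where N = "{0}"])
       (auto simp: indicator_def zero_le_mult_iff powr_mult exp_minus ennreal_mult'[symmetric] divide_simps)
  also have "\<dots> = ennreal (s powr (p - 1)) * (\<integral>\<^sup>+u. ennreal (u powr (p - 1) * exp (- (s * u))) * indicator {0<..} u \<partial>lborel)"
    by (rule nn_integral_cmult) auto
  finally have "ennreal (Gamma p) = ennreal \<bar>s\<bar> * (ennreal (s powr (p - 1)) * (\<integral>\<^sup>+u. ennreal (u powr (p - 1) * exp (- (s * u))) * indicator {0<..} u \<partial>lborel))"
    (is "_ = _ * (_ * ?I)") .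
  moreover have "ennreal (s powr p) = ennreal \<bar>s\<bar> * ennreal (s powr (p - 1))"
  proof -
    have "s powr p = \<bar>s\<bar> * s powr (p - 1)" using assms powr_mult_base[of s "p - 1"] by simp
    then show ?thesis by (metis abs_ge_zero ennreal_mult')
  qed
  ultimately have *: "ennreal (Gamma p) = ennreal (s powr p) * ?I"
    by (simp only: mult.assoc)
  have "ennreal (s powr (- p)) * ennreal (Gamma p) =
     (ennreal (s powr (-p)) * ennreal (s powr p)) * (\<integral>\<^sup>+u. ennreal (u powr (p - 1) * exp (- (s * u))) * indicator {0<..} u \<partial>lborel)"
    by (subst *) (simp add: mult.assoc)
  also have "ennreal (s powr (-p)) * ennreal (s powr p) = 1"
    using assms by (simp add: ennreal_mult'[symmetric] powr_add[symmetric])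
  finally have "?I = ennreal (s powr (- p)) * ennreal (Gamma p)" by simp
  also have "\<dots> = ennreal (Gamma p * s powr (- p))"
    by (subst ennreal_mult'[symmetric]) (simp_all add: mult.commute)
  finally show ?thesis .
qed

text \<open>Writing \<open>s powr (k - 3)\<close> as a superposition of exponentials
  (\<open>p = 3 - k\<close>) and exchanging the integrals leaves the Laplace transform of
  \<open>1 - cos\<close> integrated against \<open>u powr (2 - k)\<close>, which is the Beta-type
  integral above. Nonnegativity makes the exchange free of integrability conditions.\<close>

lemma nn_integral_1_minus_cos_powr:
  fixes k :: real
  assumes k: "0 < k" "k < 2"
  shows "(\<integral>\<^sup>+s. ennreal ((1 - cos s) * s powr (k - 3)) * indicator {0<..} s \<partial>lborel)
     = ennreal (pi / (2 * Gamma (3 - k) * sin (pi / 2 * k)))"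
proof -
  define L where "L = (\<integral>\<^sup>+s. ennreal ((1 - cos s) * s powr (k - 3)) * indicator {0<..} s \<partial>lborel)"
  have G: "0 < Gamma (3 - k)" using k by (intro Gamma_real_pos) auto
  have S: "0 < sin (pi / 2 * k)" using k by (intro sin_gt_zero) (auto simp: field_simps)
  have "ennreal (Gamma (3 - k)) * L =
     (\<integral>\<^sup>+s. ennreal (Gamma (3 - k)) * (ennreal ((1 - cos s) * s powr (k - 3)) * indicator {0<..} s) \<partial>lborel)"
    unfolding L_def by (rule nn_integral_cmult[symmetric]) auto
  also have "\<dots> = (\<integral>\<^sup>+s. (\<integral>\<^sup>+u. (ennreal (1 - cos s) * indicator {0<..} s) *
      (ennreal (u powr ((3 - k) - 1) * exp (- (s * u))) * indicator {0<..} u) \<partial>lborel) \<partial>lborel)"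
  proof (intro nn_integral_cong)
    fix s :: real
    show "ennreal (Gamma (3 - k)) * (ennreal ((1 - cos s) * s powr (k - 3)) * indicator {0<..} s) =
      (\<integral>\<^sup>+u. (ennreal (1 - cos s) * indicator {0<..} s) *
      (ennreal (u powr ((3 - k) - 1) * exp (- (s * u))) * indicator {0<..} u) \<partial>lborel)"
    proof (cases "0 < s")
      case True
      then show ?thesis
        using k G by (subst nn_integral_cmult, simp) (subst nn_integral_powr_times_exp, auto simp: ennreal_mult'[symmetric] ac_simps)
    qed auto
  qed
  also have "\<dots> = (\<integral>\<^sup>+u. (\<integral>\<^sup>+s. (ennreal (1 - cos s) * indicator {0<..} s) *
      (ennreal (u powr ((3 - k) - 1) * exp (- (s * u))) * indicator {0<..} u) \<partial>lborel) \<partial>lborel)"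
    by (rule lborel_pair.Fubini') measurable
  also have "\<dots> = (\<integral>\<^sup>+u. ennreal (u powr (1 - k) / (1 + u\<^sup>2)) * indicator {0<..} u \<partial>lborel)"
  proof (intro nn_integral_cong)
    fix u :: real
    show "(\<integral>\<^sup>+s. (ennreal (1 - cos s) * indicator {0<..} s) *
      (ennreal (u powr ((3 - k) - 1) * exp (- (s * u))) * indicator {0<..} u) \<partial>lborel)
       = ennreal (u powr (1 - k) / (1 + u\<^sup>2)) * indicator {0<..} u"
    proof (cases "0 < u")
      case True
      have "(\<integral>\<^sup>+s. (ennreal (1 - cos s) * indicator {0<..} s) *
          (ennreal (u powr ((3 - k) - 1) * exp (- (s * u))) * indicator {0<..} u) \<partial>lborel)
        = (\<integral>\<^sup>+s. ennreal (u powr (2 - k)) * (ennreal ((1 - cos s) * exp (- (s * u))) * indicator {0..} s) \<partial>lborel)"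
        using True by (intro nn_integral_cong_AE AE_I[where N = "{0}"])
           (auto simp: indicator_def ennreal_mult'[symmetric] ac_simps)
      also have "\<dots> = ennreal (u powr (2 - k)) * ennreal (1 / (u * (1 + u\<^sup>2)))"
        using True by (subst nn_integral_cmult, simp) (subst nn_integral_exp_times_1_minus_cos, auto)
      also have "u powr (2 - k) = u * u powr (1 - k)"
        using True powr_mult_base[of u "1 - k"] by simp
      finally show ?thesis using True by (simp add: ennreal_mult'[symmetric])
    qed auto
  qed
  also have "\<dots> = ennreal (pi / (2 * sin (pi / 2 * k)))"
    using nn_integral_has_integral_lebesgue[OF _ has_integral_powr_div_1_plus_square[OF k]]
    by (subst nn_integral_set_ennreal) (simp add: ac_simps)
  finally have *: "ennreal (Gamma (3 - k)) * L = ennreal (pi / (2 * sin (pi / 2 * k)))" .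
  have "L = ennreal (1 / Gamma (3 - k)) * (ennreal (Gamma (3 - k)) * L)"
    using G by (simp add: mult.assoc[symmetric] ennreal_mult'[symmetric])
  then show ?thesis unfolding * unfolding L_def using G S by (simp add: ennreal_mult'[symmetric] ac_simps)
qed

lemma has_bochner_integral_1_minus_cos_powr:
  fixes k :: real
  assumes k: "0 < k" "k < 2"
  shows "has_bochner_integral lborel (\<lambda>s. indicator {0<..} s * ((1 - cos s) * s powr (k - 3)))
     (pi / (2 * Gamma (3 - k) * sin (pi / 2 * k)))"
proof (rule has_bochner_integral_nn_integral)
  have "0 < Gamma (3 - k)" using k by (intro Gamma_real_pos) auto
  moreover have "0 < sin (pi / 2 * k)" using k by (intro sin_gt_zero) (auto simp: field_simps)
  ultimately show "0 \<le> pi / (2 * Gamma (3 - k) * sin (pi / 2 * k))" by simp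
  show "(\<integral>\<^sup>+s. ennreal (indicator {0<..} s * ((1 - cos s) * s powr (k - 3))) \<partial>lborel) =
      ennreal (pi / (2 * Gamma (3 - k) * sin (pi / 2 * k)))"
    unfolding nn_integral_1_minus_cos_powr[OF k, symmetric]
    by (intro nn_integral_cong) (auto simp: indicator_def)
qed auto

section \<open>A Fejer-type kernel\<close>

text \<open>The case \<open>k = 1\<close> of the preceding integral, where
  \<open>Gamma 2 = 1\<close> and \<open>sin (pi / 2) = 1\<close>, rescaled by
  \<open>\<bar>a\<bar>\<close>.\<close>

lemma has_bochner_integral_1_minus_cos_scale:
  fixes a :: real
  shows "has_bochner_integral lborel (\<lambda>s. indicator {0<..} s * ((1 - cos (a * s)) / s\<^sup>2)) (\<bar>a\<bar> * pi / 2)"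
proof (cases "a = 0")
  case False
  define f where "f = (\<lambda>s::real. indicator {0<..} s * ((1 - cos s) * s powr (1 - 3)))"
  have G: "Gamma (2::real) = 1" using Gamma_fact[of 1, where ?'a = real] by simp
  have "has_bochner_integral lborel f (pi / 2)"
    using has_bochner_integral_1_minus_cos_powr[of 1] by (simp add: f_def G)
  then have "has_bochner_integral lborel (\<lambda>s. f (0 + \<bar>a\<bar> * s)) ((pi / 2) /\<^sub>R \<bar>\<bar>a\<bar>\<bar>)"
    using False by (subst (asm) lborel_has_bochner_integral_real_affine_iff[where c = "\<bar>a\<bar>" and t = 0]) auto
  then have "has_bochner_integral lborel (\<lambda>s. a\<^sup>2 * f (0 + \<bar>a\<bar> * s)) (a\<^sup>2 * ((pi / 2) /\<^sub>R \<bar>\<bar>a\<bar>\<bar>))"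
    by (intro has_bochner_integral_mult_right)
  moreover have "a\<^sup>2 * f (0 + \<bar>a\<bar> * s) = indicator {0<..} s * ((1 - cos (a * s)) / s\<^sup>2)" for s
  proof (cases "0 < s")
    case True
    have "cos (\<bar>a\<bar> * s) = cos (a * s)" by (cases "0 \<le> a") auto
    moreover have "(\<bar>a\<bar> * s) powr (1 - 3) = 1 / (a\<^sup>2 * s\<^sup>2)"
      using True False powr_minus_divide[of "\<bar>a\<bar> * s" 2] by (simp add: power_mult_distrib)
    ultimately show ?thesis using True False by (simp add: f_def)
  next
    case s: False
    then have "\<not> 0 < \<bar>a\<bar> * s" using False by (simp add: zero_less_mult_iff)
    then show ?thesis using s by (simp add: f_def)
  qed
  moreover have "a\<^sup>2 * ((pi / 2) /\<^sub>R \<bar>\<bar>a\<bar>\<bar>) = \<bar>a\<bar> * pi / 2"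
    using False by (simp add: divide_simps) (metis abs_mult_self_eq power2_eq_square mult.assoc)
  ultimately show ?thesis by (simp only:)
qed (simp add: has_bochner_integral_zero)

text \<open>By product-to-sum, \<open>(1 - cos s) * cos (u * s)\<close> is a combination of
  \<open>1 - cos (a * s)\<close> with \<open>a = 1 + u\<close>, \<open>1 - u\<close>,
  \<open>u\<close>. The corresponding values \<open>\<bar>a\<bar> * pi / 2\<close> combine to the
  triangle function.\<close>

lemma has_bochner_integral_Fejer:
  fixes u :: real
  assumes u: "0 \<le> u"
  shows "has_bochner_integral lborel (\<lambda>s. indicator {0<..} s * ((1 - cos s) * cos (u * s) / s\<^sup>2)) (pi / 2 * max 0 (1 - u))"
proof -
  let ?f = "\<lambda>a s. indicator {0<..} s * ((1 - cos (a * s)) / s\<^sup>2) :: real"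
  have "has_bochner_integral lborel (\<lambda>s. (1/2) * ?f (1 + u) s + (1/2) * ?f (1 - u) s - ?f u s)
     ((1/2) * (\<bar>1 + u\<bar> * pi / 2) + (1/2) * (\<bar>1 - u\<bar> * pi / 2) - \<bar>u\<bar> * pi / 2)"
    by (intro has_bochner_integral_diff has_bochner_integral_add has_bochner_integral_mult_right
        has_bochner_integral_1_minus_cos_scale)
  moreover have "(1/2) * ?f (1 + u) s + (1/2) * ?f (1 - u) s - ?f u s =
       indicator {0<..} s * ((1 - cos s) * cos (u * s) / s\<^sup>2)" for s
  proof -
    have "(1/2) * (1 - cos ((1 + u) * s)) + (1/2) * (1 - cos ((1 - u) * s)) - (1 - cos (u * s)) = (1 - cos s) * cos (u * s)"
      by (simp add: ring_distribs cos_add cos_diff)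
    then have "((1/2) * (1 - cos ((1 + u) * s)) + (1/2) * (1 - cos ((1 - u) * s)) - (1 - cos (u * s))) / s\<^sup>2
        = (1 - cos s) * cos (u * s) / s\<^sup>2" by simp
    then show ?thesis by (cases "s > 0") (simp_all add: add_divide_distrib diff_divide_distrib)
  qed
  moreover have "(1/2) * (\<bar>1 + u\<bar> * pi / 2) + (1/2) * (\<bar>1 - u\<bar> * pi / 2) - \<bar>u\<bar> * pi / 2 = pi / 2 * max 0 (1 - u)"
    using u by (auto simp: max_def abs_if field_simps)
  ultimately show ?thesis by (simp only:)
qed

text \<open>The integrability criterion behind every exchange of Bochner integrals below: each
  integrand there is dominated by a function of one variable times a function of the other.\<close>

lemma (in pair_sigma_finite) integrable_bounded_by_product:
  fixes f :: "'a \<times> 'b \<Rightarrow> real"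
  assumes f: "f \<in> borel_measurable (M1 \<Otimes>\<^sub>M M2)"
    and g: "integrable M1 g" and h: "integrable M2 h"
    and le: "\<And>x y. x \<in> space M1 \<Longrightarrow> y \<in> space M2 \<Longrightarrow> \<bar>f (x, y)\<bar> \<le> g x * h y"
  shows "integrable (M1 \<Otimes>\<^sub>M M2) f"
proof (rule Bochner_Integration.integrable_bound[OF _ f])
  have [measurable]: "g \<in> borel_measurable M1" "h \<in> borel_measurable M2" using g h by auto
  show "integrable (M1 \<Otimes>\<^sub>M M2) (\<lambda>(x, y). g x * h y)"
  proof (rule Fubini_integrable)
    show "integrable M1 (\<lambda>x. \<integral>y. norm (case (x, y) of (x, y) \<Rightarrow> g x * h y) \<partial>M2)"
      using g h by (simp add: abs_mult)
    show "AE x in M1. integrable M2 (\<lambda>y. case (x, y) of (x, y) \<Rightarrow> g x * h y)"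
      using h by simp
  qed measurable
  show "AE p in M1 \<Otimes>\<^sub>M M2. norm (f p) \<le> norm (case p of (x, y) \<Rightarrow> g x * h y)"
  proof (intro AE_I2)
    fix p assume p: "p \<in> space (M1 \<Otimes>\<^sub>M M2)"
    obtain x y where "p = (x, y)" by (cases p)
    with p le[of x y] show "norm (f p) \<le> norm (case p of (x, y) \<Rightarrow> g x * h y)"
      by (auto simp: space_pair_measure)
  qed
qed

text \<open>For \<open>u > 0\<close> this is the sign of \<open>y\<close> when
  \<open>\<bar>y\<bar> > u\<close>, half of it when \<open>\<bar>y\<bar> = u\<close>, and
  \<open>0\<close> otherwise. The value one half at the boundary mirrors the averaging in the
  intermediate distribution function, so that the mean of \<open>tail_kernel u X\<close> is exactly
  the tail difference at \<open>u\<close>.\<close>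

definition tail_kernel :: "real \<Rightarrow> real \<Rightarrow> real" where
  "tail_kernel u y = (of_bool (u \<le> y) + of_bool (u < y) - of_bool (y < - u) - of_bool (y \<le> - u)) / 2"

text \<open>The Fejer weight on the positive half-line, whose cosine transform is
  \<open>(1 - cos s) / s^2\<close>.\<close>

definition triangle :: "real \<Rightarrow> real" where
  "triangle u = indicator {0<..} u * max 0 (1 - u)"

lemma triangle_nonneg: "0 \<le> triangle u" by (simp add: triangle_def)

lemma abs_tail_kernel_le: "\<bar>tail_kernel u y\<bar> \<le> 1"
  by (auto simp: tail_kernel_def)

lemma borel_measurable_triangle [measurable]: "triangle \<in> borel_measurable borel"
  unfolding triangle_def by measurable

lemma borel_measurable_tail_kernel [measurable]:
  "(\<lambda>(u, y). tail_kernel u y) \<in> borel_measurable (borel \<Otimes>\<^sub>M borel)"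
  unfolding tail_kernel_def by measurable

lemma has_bochner_integral_triangle: "has_bochner_integral lborel triangle (1/2)"
proof -
  have "has_bochner_integral lborel (\<lambda>u. (1 - u) * indicator {0..1} u) ((1 - 1\<^sup>2 / 2) - (0 - 0\<^sup>2 / 2 :: real))"
    by (rule has_bochner_integral_FTC_Icc_nonneg[where F = "\<lambda>u. u - u\<^sup>2 / 2"])
       (auto intro!: derivative_eq_intros)
  then have "has_bochner_integral lborel (\<lambda>u. (1 - u) * indicator {0..1} u) (1/2 :: real)" by simp
  then show ?thesis
    by (rule has_bochner_integral_cong_AE[THEN iffD1, rotated 3])
       (auto intro!: AE_I[where N = "{0}"] simp: triangle_def indicator_def)
qed

text \<open>To be read as \<open>sin (s * y) / s\<close> times the Fejer factor
  \<open>(1 - cos s) / s^2\<close>; the first factor is the integral of \<open>cos (u * s)\<close>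
  over \<open>u\<close> in \<open>[0, y]\<close>.\<close>

abbreviation sine_kernel :: "real \<Rightarrow> real \<Rightarrow> real" where
  "sine_kernel y s \<equiv> sin (s * y) * ((1 - cos s) / s ^ 3)"

text \<open>The estimate \<open>\<bar>sin (s * y)\<bar> \<le> s * \<bar>y\<bar>\<close> for
  \<open>s > 0\<close> cancels one power of \<open>s\<close>. The resulting majorant grows with
  \<open>\<bar>y\<bar>\<close>, so it does not by itself allow averaging over a random
  \<open>y\<close>.\<close>

lemma integrable_sine_kernel: "integrable lborel (\<lambda>s. indicator {0<..} s * sine_kernel y s)"
proof (rule Bochner_Integration.integrable_bound)
  show "integrable lborel (\<lambda>s. \<bar>y\<bar> * (indicator {0<..} s * ((1 - cos (1 * s)) / s\<^sup>2)))"
    using has_bochner_integral_1_minus_cos_scale[of 1] by (intro integrable_mult_right) (simp add: has_bochner_integral_iff)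
  show "AE s in lborel. norm (indicator {0<..} s * sine_kernel y s)
      \<le> norm (\<bar>y\<bar> * (indicator {0<..} s * ((1 - cos (1 * s)) / s\<^sup>2)))"
  proof (rule AE_I2)
    fix s :: real
    show "norm (indicator {0<..} s * sine_kernel y s) \<le> norm (\<bar>y\<bar> * (indicator {0<..} s * ((1 - cos (1 * s)) / s\<^sup>2)))"
    proof (cases "0 < s")
      case True
      have "\<bar>sin (s * y)\<bar> * ((1 - cos s) / s ^ 3) \<le> \<bar>s * y\<bar> * ((1 - cos s) / s ^ 3)"
        using True by (intro mult_right_mono abs_sin_x_le_abs_x) auto
      also have "\<dots> = \<bar>y\<bar> * ((1 - cos s) / s\<^sup>2)"
        using True by (simp add: abs_mult power2_eq_square power3_eq_cube)
      finally show ?thesis using True by (simp add: abs_mult)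
    qed simp
  qed
qed measurable

text \<open>Expanding \<open>sin (s * y) / s\<close> as an integral of cosines over
  \<open>[0, y]\<close> and exchanging the integrals leaves the Fejer integral for each
  \<open>u\<close>, that is, the triangle weight cut off at \<open>y\<close>.\<close>

lemma integral_sine_kernel_pos:
  assumes y: "0 < y"
  shows "(\<integral>s. indicator {0<..} s * sine_kernel y s \<partial>lborel) = pi / 2 * (\<integral>u. triangle u * tail_kernel u y \<partial>lborel)"
proof -
  let ?F = "\<lambda>s u. indicator {0<..} s * ((1 - cos s) * cos (u * s) / s\<^sup>2) * indicator {0..y} u :: real"
  have "(\<integral>s. indicator {0<..} s * sine_kernel y s \<partial>lborel) = (\<integral>s. (\<integral>u. ?F s u \<partial>lborel) \<partial>lborel)"
  proof (rule Bochner_Integration.integral_cong[OF refl])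
    fix s :: real
    show "indicator {0<..} s * sine_kernel y s = (\<integral>u. ?F s u \<partial>lborel)"
    proof (cases "0 < s")
      case True
      have "(\<integral>u. indicator {0..y} u *\<^sub>R cos (u * s) \<partial>lborel) = sin (y * s) / s - sin (0 * s) / s"
        by (rule integral_FTC_Icc)
           (use y True in \<open>auto intro!: derivative_eq_intros continuous_intros
              simp: has_real_derivative_iff_has_vector_derivative[symmetric]\<close>)
      moreover have "(\<integral>u. ?F s u \<partial>lborel) = (\<integral>u. ((1 - cos s) / s\<^sup>2) * (indicator {0..y} u *\<^sub>R cos (u * s)) \<partial>lborel)"
        using True by (intro Bochner_Integration.integral_cong) (auto simp: indicator_def)
      ultimately have "(\<integral>u. ?F s u \<partial>lborel) = ((1 - cos s) / s\<^sup>2) * (sin (y * s) / s)"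
        by simp
      then show ?thesis using True by (simp add: mult.commute power2_eq_square power3_eq_cube)
    qed simp
  qed
  also have "\<dots> = (\<integral>u. (\<integral>s. ?F s u \<partial>lborel) \<partial>lborel)"
  proof (rule lborel_pair.Fubini_integral[symmetric], rule lborel_pair.integrable_bounded_by_product)
    show "integrable lborel (\<lambda>s. indicator {0<..} s * ((1 - cos (1 * s)) / s\<^sup>2) :: real)"
      using has_bochner_integral_1_minus_cos_scale[of 1] by (simp add: has_bochner_integral_iff)
    show "integrable lborel (indicator {0..y} :: real \<Rightarrow> real)"
      using y by (intro integrable_real_indicator) (auto simp: emeasure_lborel_Icc)
    fix s u :: real
    have "\<bar>(1 - cos s) * cos (u * s) / s\<^sup>2\<bar> \<le> (1 - cos s) / s\<^sup>2"
      using mult_left_mono[OF abs_cos_le_one[of "u * s"], of "1 - cos s"]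
      by (simp add: abs_mult divide_right_mono)
    then show "\<bar>case (s, u) of (s, u) \<Rightarrow> ?F s u\<bar> \<le> indicator {0<..} s * ((1 - cos (1 * s)) / s\<^sup>2) * indicator {0..y} u"
      by (auto simp: indicator_def)
  qed measurable
  also have "\<dots> = (\<integral>u. pi / 2 * (triangle u * tail_kernel u y) \<partial>lborel)"
  proof (rule integral_cong_AE)
    \<comment> \<open>The two excluded points are genuine exceptions: at \<open>u = 0\<close> the
      weight \<open>triangle\<close> is \<open>0\<close>, and at \<open>u = y\<close> the tail
      kernel is one half, whereas the indicator of \<open>[0, y]\<close> is
      \<open>1\<close>.\<close>
    have "(\<integral>s. ?F s u \<partial>lborel) = pi / 2 * (triangle u * tail_kernel u y)" if "u \<noteq> 0" "u \<noteq> y" for u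
    proof (cases "0 < u")
      case True
      have "(\<integral>s. ?F s u \<partial>lborel) = pi / 2 * max 0 (1 - u) * indicator {0..y} u"
        unfolding integral_mult_left_zero
        using has_bochner_integral_Fejer[of u] True by (simp only: has_bochner_integral_iff less_imp_le)
      then show ?thesis using True that y by (auto simp: triangle_def tail_kernel_def indicator_def)
    next
      case False
      then show ?thesis using that by (simp add: triangle_def)
    qed
    then show "AE u in lborel. (\<integral>s. ?F s u \<partial>lborel) = pi / 2 * (triangle u * tail_kernel u y)"
      by (intro AE_I[where N = "{0, y}"]) (auto simp: emeasure_lborel_countable)
  qed measurable
  finally show ?thesis by simp
qed

text \<open>Both sides are odd in \<open>y\<close>.\<close>

lemma integral_sine_kernel:
  "(\<integral>s. indicator {0<..} s * sine_kernel y s \<partial>lborel) = pi / 2 * (\<integral>u. triangle u * tail_kernel u y \<partial>lborel)"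
proof (cases "0 < y")
  case True
  then show ?thesis by (rule integral_sine_kernel_pos)
next
  case False
  have odd: "tail_kernel u (- y) = - tail_kernel u y" for u
    by (auto simp: tail_kernel_def)
  show ?thesis
  proof (cases "y = 0")
    case True
    have "(\<lambda>u. triangle u * tail_kernel u y) = (\<lambda>u. 0)"
      using True by (auto simp: triangle_def tail_kernel_def)
    then have "(\<integral>u. triangle u * tail_kernel u y \<partial>lborel) = 0" by (simp only: lebesgue_integral_const) simp
    then show ?thesis using True by simp
  next
    assume "y \<noteq> 0"
    with False integral_sine_kernel_pos[of "- y"] show ?thesis
      by (simp add: odd)
  qed
qed

text \<open>Unlike the majorant for integrability, the closed form is bounded uniformly in
  \<open>y\<close>: the tail kernel is at most \<open>1\<close> in absolute value and the triangle
  has mass \<open>1/2\<close>.\<close>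

lemma abs_integral_sine_kernel_le: "\<bar>\<integral>s. indicator {0<..} s * sine_kernel y s \<partial>lborel\<bar> \<le> pi"
proof -
  have "norm (\<integral>u. triangle u * tail_kernel u y \<partial>lborel) \<le> (\<integral>u. triangle u \<partial>lborel)"
  proof (rule Bochner_Integration.integral_norm_bound_integral)
    show int: "integrable lborel triangle"
      using has_bochner_integral_triangle by (simp add: has_bochner_integral_iff)
    show le: "norm (triangle u * tail_kernel u y) \<le> triangle u" for u
      by (simp add: abs_mult triangle_nonneg abs_tail_kernel_le mult_left_le)
    show "integrable lborel (\<lambda>u. triangle u * tail_kernel u y)"
      by (rule Bochner_Integration.integrable_bound[OF int])
         (use le in \<open>auto simp: triangle_nonneg\<close>)
  qed
  also have "\<dots> = 1/2" using has_bochner_integral_triangle by (simp add: has_bochner_integral_iff)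
  finally show ?thesis unfolding integral_sine_kernel by (simp add: abs_mult)
qed

section \<open>Potter bounds\<close>

text \<open>Absolute values make the bound independent of the sign of \<open>V\<close>, and the
  slack between \<open>l powr k\<close> and \<open>c\<close> makes it hold exactly for small
  \<open>t\<close>, so that it can be iterated.\<close>

lemma regularly_varying_at_0_bounded_ratio:
  assumes rv: "regularly_varying_at_0 V k" and l: "0 < l" and c: "l powr k < c"
  shows "\<exists>d>0. \<forall>t. 0 < t \<and> t < d \<longrightarrow> \<bar>V (l * t)\<bar> \<le> c * \<bar>V t\<bar>"
proof -
  obtain d0 where d0: "0 < d0" "\<And>t. 0 < t \<Longrightarrow> t < d0 \<Longrightarrow> V t \<noteq> 0"
    using regularly_varying_at_0_nonzero[OF rv] by blast
  have "((\<lambda>t. \<bar>V (l * t) / V t\<bar>) \<longlongrightarrow> \<bar>l powr k\<bar>) (at_right 0)"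
    using rv l unfolding regularly_varying_at_0_def by (intro tendsto_rabs) auto
  then have "\<forall>\<^sub>F t in at_right 0. \<bar>V (l * t) / V t\<bar> < c"
    by (rule order_tendstoD) (use c in simp)
  then obtain d1 where d1: "0 < d1" "\<And>t. 0 < t \<Longrightarrow> t < d1 \<Longrightarrow> \<bar>V (l * t) / V t\<bar> < c"
    by (auto simp: eventually_at_right_field)
  have "\<bar>V (l * t)\<bar> \<le> c * \<bar>V t\<bar>" if "0 < t" "t < min d0 d1" for t
    using d0(2)[of t] d1(2)[of t] that by (simp add: abs_divide divide_less_eq)
  then show ?thesis using d0(1) d1(1) by (intro exI[of _ "min d0 d1"]) auto
qed

text \<open>Baire's theorem takes the place of the uniform convergence theorem: some set
  \<open>A n\<close> of multipliers admitting a common bound contains an interval.\<close>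

lemma regularly_varying_at_0_locally_bounded:
  assumes cont: "continuous_on UNIV V" and rv: "regularly_varying_at_0 V k"
  shows "\<exists>B>0. \<exists>d>0. \<forall>l\<in>{1..2}. \<forall>t. 0 < t \<and> t < d \<longrightarrow> \<bar>V (l * t)\<bar> \<le> B * \<bar>V t\<bar>"
proof -
  \<comment> \<open>The index \<open>n\<close> bounds both the ratio and the reciprocal of the range
    of \<open>t\<close>, so that countably many sets cover \<open>[1, 2]\<close>.\<close>
  define A where "A = (\<lambda>n::nat. {l\<in>{1..2}. \<forall>t. 0 < t \<and> t < 1 / (real n + 1) \<longrightarrow> \<bar>V (l * t)\<bar> \<le> real n * \<bar>V t\<bar>})"
  have closed: "closed (A n)" for n
  proof -
    have "A n = {1..2} \<inter> (\<Inter>t\<in>{0<..<1 / (real n + 1)}. {l. \<bar>V (l * t)\<bar> \<le> real n * \<bar>V t\<bar>})"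
      by (auto simp: A_def)
    moreover have "closed {l. \<bar>V (l * t)\<bar> \<le> real n * \<bar>V t\<bar>}" for t
      by (intro closed_Collect_le continuous_intros continuous_on_compose2[OF cont]) auto
    ultimately show ?thesis by (auto intro!: closed_Int closed_INT)
  qed
  have cover: "\<exists>n. l \<in> A n" if l: "l \<in> {1..2}" for l
  proof -
    obtain d where d: "0 < d" "\<And>t. 0 < t \<Longrightarrow> t < d \<Longrightarrow> \<bar>V (l * t)\<bar> \<le> (l powr k + 1) * \<bar>V t\<bar>"
      using regularly_varying_at_0_bounded_ratio[OF rv, of l "l powr k + 1"] l by auto
    obtain n :: nat where n: "max (l powr k + 1) (1 / d) < real n" using reals_Archimedean2 by blast
    have "\<bar>V (l * t)\<bar> \<le> real n * \<bar>V t\<bar>" if t: "0 < t" "t < 1 / (real n + 1)" for t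
    proof -
      have "1 / (real n + 1) < d" using n d(1) by (simp add: divide_less_eq mult.commute) (smt (verit) mult_left_mono)
      then have "\<bar>V (l * t)\<bar> \<le> (l powr k + 1) * \<bar>V t\<bar>" using t d(2)[of t] by simp
      also have "\<dots> \<le> real n * \<bar>V t\<bar>" using n by (intro mult_right_mono) auto
      finally show ?thesis .
    qed
    then show ?thesis using l by (auto simp: A_def)
  qed
  \<comment> \<open>If every complement were dense in \<open>[1, 2]\<close>, the complements would
    be dense relatively open sets with dense intersection; but the intersection is empty because the
    \<open>A n\<close> cover.\<close>
  have "\<exists>n. \<not> {1..2} \<subseteq> closure ({1..2} - A n)"
  proof (rule ccontr)
    assume *: "\<nexists>n. \<not> {1..2} \<subseteq> closure ({1..2} - A n)"
    have "{1..2::real} \<subseteq> closure (\<Inter>(range (\<lambda>n. {1..2} - A n)))"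
    proof (rule Baire)
      fix T assume "T \<in> range (\<lambda>n. {1..2} - A n)"
      then obtain n where T: "T = {1..2} - A n" by auto
      have "openin (top_of_set {1..2}) ({1..2} \<inter> - A n)"
        using closed[of n] by (intro openin_open_Int) auto
      then show "openin (top_of_set {1..2}) T \<and> {1..2} \<subseteq> closure T"
        using * T by (auto simp: Diff_eq)
    qed auto
    moreover have "\<Inter>(range (\<lambda>n. {1..2} - A n)) = {}" using cover by auto
    ultimately have "{1..2::real} \<subseteq> {}" by (simp only: closure_empty)
    then show False by simp
  qed
  then obtain n x where x: "x \<in> {1..2}" "x \<notin> closure ({1..2} - A n)" by blast
  then obtain e where e: "0 < e" "\<And>y. y \<in> {1..2} - A n \<Longrightarrow> \<not> dist y x < e"
    unfolding closure_approachable by blast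
  \<comment> \<open>The point \<open>x\<close> is interior to \<open>A n\<close> relative to
    \<open>[1, 2]\<close>; the interval is taken to its right, or to its left when \<open>x\<close>
    is the endpoint \<open>2\<close>.\<close>
  obtain c c' where c: "1 \<le> c" "c < c'" "{c..c'} \<subseteq> A n"
  proof (cases "x < 2")
    case True
    have "{x..min 2 (x + e / 2)} \<subseteq> A n"
    proof
      fix y assume "y \<in> {x..min 2 (x + e / 2)}"
      then have "dist y x < e" "y \<in> {1..2}" using x e(1) by (auto simp: dist_real_def)
      then show "y \<in> A n" using e(2)[of y] by auto
    qed
    then show ?thesis using that[of x "min 2 (x + e / 2)"] True x e(1) by auto
  next
    case False
    then have x2: "x = 2" using x by auto
    have "{max 1 (2 - e / 2)..2} \<subseteq> A n"
    proof
      fix y assume "y \<in> {max 1 (2 - e / 2)..2}"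
      then have "dist y x < e" "y \<in> {1..2}" using x2 e(1) by (auto simp: dist_real_def)
      then show "y \<in> A n" using e(2)[of y] by auto
    qed
    then show ?thesis using that[of "max 1 (2 - e / 2)" 2] e(1) by auto
  qed
  define r where "r = c' / c"
  have r: "1 < r" using c by (simp add: r_def)
  have bd: "\<bar>V (l * t)\<bar> \<le> real n * \<bar>V t\<bar>" if "c \<le> l" "l \<le> c'" "0 < t" "t < 1 / (real n + 1)" for l t
    using c(3) that by (auto simp: A_def)
  have step: "\<exists>B>0. \<exists>d>0. \<forall>l\<in>{1..r ^ j}. \<forall>t. 0 < t \<and> t < d \<longrightarrow> \<bar>V (l * t)\<bar> \<le> B * \<bar>V t\<bar>" for j
  proof (induction j)
    case 0
    show ?case by (rule exI[of _ 1], simp, rule exI[of _ 1], simp)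
  next
    case (Suc j)
    then obtain B d where B: "0 < B" "0 < d"
      "\<And>l t. l \<in> {1..r ^ j} \<Longrightarrow> 0 < t \<Longrightarrow> t < d \<Longrightarrow> \<bar>V (l * t)\<bar> \<le> B * \<bar>V t\<bar>" by blast
    \<comment> \<open>A new multiplier \<open>l\<close> in \<open>(r^j, r^(j+1)]\<close> factors as
      \<open>(l / m) * m\<close> with \<open>l / m\<close> in \<open>[c, c']\<close>, where the
      bound from \<open>A n\<close> applies; the single multiplier \<open>m\<close> is controlled by
      regular variation. The last term of \<open>d''\<close> keeps \<open>m * t\<close> in the range
      of \<open>A n\<close>.\<close>
    define m where "m = r ^ j / c"
    have m: "0 < m" using r c by (simp add: m_def)
    obtain d' where d': "0 < d'" "\<And>t. 0 < t \<Longrightarrow> t < d' \<Longrightarrow> \<bar>V (m * t)\<bar> \<le> (m powr k + 1) * \<bar>V t\<bar>"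
      using regularly_varying_at_0_bounded_ratio[OF rv m, of "m powr k + 1"] by auto
    define d'' where "d'' = min (min d d') (1 / (real n + 1) / m)"
    define B' where "B' = max B (real n * (m powr k + 1))"
    have "\<bar>V (l * t)\<bar> \<le> B' * \<bar>V t\<bar>" if l: "l \<in> {1..r ^ Suc j}" and t: "0 < t" "t < d''" for l t
    proof (cases "l \<le> r ^ j")
      case True
      then have "\<bar>V (l * t)\<bar> \<le> B * \<bar>V t\<bar>" using B(3)[of l t] l t by (simp add: d''_def)
      also have "\<dots> \<le> B' * \<bar>V t\<bar>" by (intro mult_right_mono) (auto simp: B'_def)
      finally show ?thesis .
    next
      case False
      have "c \<le> l / m" using False m c r by (simp add: m_def pos_le_divide_eq)
      moreover have "l / m \<le> c'" using l m c r by (simp add: m_def r_def divide_simps mult.commute)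
      moreover have "m * t < 1 / (real n + 1)" using t m unfolding d''_def by (simp only: min_less_iff_conj pos_less_divide_eq mult.commute)
      ultimately have "\<bar>V ((l / m) * (m * t))\<bar> \<le> real n * \<bar>V (m * t)\<bar>"
        using m t by (intro bd) auto
      also have "\<dots> \<le> real n * ((m powr k + 1) * \<bar>V t\<bar>)"
        using t d'(2)[of t] by (intro mult_left_mono) (auto simp: d''_def)
      also have "\<dots> \<le> B' * \<bar>V t\<bar>" unfolding mult.assoc[symmetric] by (intro mult_right_mono) (auto simp: B'_def)
      finally show ?thesis using m by simp
    qed
    moreover have "0 < B'" "0 < d''" using B d' m by (auto simp: B'_def d''_def)
    ultimately show ?case by blast
  qed
  obtain j where j: "2 < r ^ j" using real_arch_pow[OF r] by blast
  obtain B d where "0 < B" "0 < d" and Bd: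
    "\<forall>l\<in>{1..r ^ j}. \<forall>t. 0 < t \<and> t < d \<longrightarrow> \<bar>V (l * t)\<bar> \<le> B * \<bar>V t\<bar>" using step[of j] by blast
  moreover have "\<forall>l\<in>{1..2}. \<forall>t. 0 < t \<and> t < d \<longrightarrow> \<bar>V (l * t)\<bar> \<le> B * \<bar>V t\<bar>"
    using Bd j by auto
  ultimately show ?thesis by blast
qed

lemma ex_dyadic_interval:
  fixes s :: real
  assumes "1 \<le> s"
  shows "\<exists>n. 2 ^ n \<le> s \<and> s < 2 ^ Suc n"
proof -
  define m where "m = (LEAST n. s < 2 ^ n)"
  have m: "s < 2 ^ m" unfolding m_def by (rule LeastI_ex) (rule real_arch_pow, simp)
  have "m \<noteq> 0" using m assms by (intro notI) simp
  then obtain n where n: "m = Suc n" by (cases m) auto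
  have "\<not> s < 2 ^ n" unfolding m_def[symmetric] by (rule not_less_Least) (use n m_def in simp)
  then have "2 ^ n \<le> s" by simp
  then show ?thesis using m unfolding n by blast
qed

text \<open>Halving and doubling the argument of \<open>V\<close> change
  \<open>\<bar>V\<bar>\<close> by at most the factors \<open>(1/2) powr (k - e)\<close> and
  \<open>2 powr (k + e)\<close> near \<open>0\<close>. Iterating over dyadic multipliers and
  bridging the remaining factor in \<open>[1, 2]\<close> by local boundedness gives the two powers.
  Boundedness of \<open>V\<close> extends the estimate to \<open>s * t\<close> far from
  \<open>0\<close>.\<close>

lemma Potter_bound:
  assumes cont: "continuous_on UNIV V" and rv: "regularly_varying_at_0 V k"
    and bdd: "\<And>t. \<bar>V t\<bar> \<le> 1" and e: "0 < e" "e < k"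
  shows "\<exists>C>0. \<exists>d>0. \<forall>t s. 0 < t \<and> t < d \<and> 0 < s \<longrightarrow>
    \<bar>V (s * t)\<bar> \<le> C * (s powr (k - e) + s powr (k + e)) * \<bar>V t\<bar>"
proof -
  obtain B0 d1 where B0: "0 < B0" and d1: "0 < d1"
    "\<And>l t. l \<in> {1..2} \<Longrightarrow> 0 < t \<Longrightarrow> t < d1 \<Longrightarrow> \<bar>V (l * t)\<bar> \<le> B0 * \<bar>V t\<bar>"
    using regularly_varying_at_0_locally_bounded[OF cont rv] by blast
  obtain d2 where d2: "0 < d2" "\<And>t. 0 < t \<Longrightarrow> t < d2 \<Longrightarrow> \<bar>V ((1/2) * t)\<bar> \<le> (1/2) powr (k - e) * \<bar>V t\<bar>"
    using regularly_varying_at_0_bounded_ratio[OF rv, of "1/2" "(1/2) powr (k - e)"] e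
    by (auto simp: powr_less_mono')
  obtain d3 where d3: "0 < d3" "\<And>t. 0 < t \<Longrightarrow> t < d3 \<Longrightarrow> \<bar>V (2 * t)\<bar> \<le> 2 powr (k + e) * \<bar>V t\<bar>"
    using regularly_varying_at_0_bounded_ratio[OF rv, of "2" "2 powr (k + e)"] e by auto
  obtain d4 where d4: "0 < d4" "\<And>t. 0 < t \<Longrightarrow> t < d4 \<Longrightarrow> V t \<noteq> 0"
    using regularly_varying_at_0_nonzero[OF rv] by blast
  define d where "d = min (min d1 d2) (min d3 d4)"
  have d: "0 < d" using d1 d2 d3 d4 by (simp add: d_def)
  have down: "\<bar>V (t / 2 ^ n)\<bar> \<le> (1 / 2 ^ n) powr (k - e) * \<bar>V t\<bar>" if t: "0 < t" "t < d" for t n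
  proof (induction n)
    case (Suc n)
    have "t / 2 ^ n \<le> t" using t by (simp add: divide_le_eq)
    then have "\<bar>V ((1/2) * (t / 2 ^ n))\<bar> \<le> (1/2) powr (k - e) * \<bar>V (t / 2 ^ n)\<bar>"
      using t by (intro d2(2)) (auto simp: d_def)
    also have "\<dots> \<le> (1/2) powr (k - e) * ((1 / 2 ^ n) powr (k - e) * \<bar>V t\<bar>)"
      by (intro mult_left_mono Suc) auto
    also have "\<dots> = ((1/2) * (1 / 2 ^ n)) powr (k - e) * \<bar>V t\<bar>"
      by (simp only: powr_mult mult.assoc)
    finally show ?case by simp
  qed simp
  have up: "2 ^ n * t < d \<Longrightarrow> \<bar>V (2 ^ n * t)\<bar> \<le> (2 ^ n) powr (k + e) * \<bar>V t\<bar>" if t: "0 < t" for t n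
  proof (induction n)
    case (Suc n)
    have "2 ^ n * t < d" using Suc.prems t by (simp add: mult.assoc) (smt (verit) zero_less_mult_iff zero_less_power)
    then have "\<bar>V (2 * (2 ^ n * t))\<bar> \<le> 2 powr (k + e) * \<bar>V (2 ^ n * t)\<bar>"
      using t by (intro d3(2)) (auto simp: d_def)
    also have "\<dots> \<le> 2 powr (k + e) * ((2 ^ n) powr (k + e) * \<bar>V t\<bar>)"
      by (intro mult_left_mono Suc.IH) (use \<open>2 ^ n * t < d\<close> in auto)
    also have "\<dots> = (2 * 2 ^ n) powr (k + e) * \<bar>V t\<bar>"
      by (simp only: powr_mult mult.assoc)
    finally show ?case by (simp add: mult.assoc)
  qed simp
  have small: "\<bar>V (s * t)\<bar> \<le> B0 * s powr (k - e) * \<bar>V t\<bar>" if t: "0 < t" "t < d" and s: "0 < s" "s < 1" for s t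
  proof -
    obtain n where n: "2 ^ n \<le> 1 / s" "1 / s < 2 ^ Suc n" using ex_dyadic_interval[of "1 / s"] s by auto
    let ?n = "Suc n"
    \<comment> \<open>Descending one dyadic level below \<open>s * t\<close> leaves a multiplier in
      \<open>[1, 2]\<close> and keeps the base point \<open>t / 2 ^ ?n\<close> below
      \<open>d\<close>.\<close>
    have l: "s * 2 ^ ?n \<in> {1..2}" using n s by (simp add: field_simps)
    have "t / 2 ^ ?n \<le> t" using t one_le_power[of 2 ?n] by (simp add: divide_le_eq mult_le_cancel_left1 del: power_Suc)
    then have "\<bar>V ((s * 2 ^ ?n) * (t / 2 ^ ?n))\<bar> \<le> B0 * \<bar>V (t / 2 ^ ?n)\<bar>"
      using t l by (intro d1(2)) (auto simp: d_def)
    also have "\<dots> \<le> B0 * ((1 / 2 ^ ?n) powr (k - e) * \<bar>V t\<bar>)"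
      using B0 t by (intro mult_left_mono down) auto
    also have "(1 / 2 ^ ?n) powr (k - e) \<le> s powr (k - e)"
      using l s e by (intro powr_mono2) (auto simp: field_simps)
    finally show ?thesis using B0 by (simp add: mult.assoc mult_left_mono mult_right_mono)
  qed
  have large: "\<bar>V (s * t)\<bar> \<le> B0 * s powr (k + e) * \<bar>V t\<bar>" if t: "0 < t" "s * t < d" and s: "1 \<le> s" for s t
  proof -
    obtain n where n: "2 ^ n \<le> s" "s < 2 ^ Suc n" using ex_dyadic_interval[OF s] by auto
    have nt: "2 ^ n * t < d" using n t by (smt (verit) mult_right_mono)
    have "s / 2 ^ n \<in> {1..2}" using n by (simp add: field_simps)
    then have "\<bar>V ((s / 2 ^ n) * (2 ^ n * t))\<bar> \<le> B0 * \<bar>V (2 ^ n * t)\<bar>"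
      using t nt by (intro d1(2)) (auto simp: d_def)
    also have "\<dots> \<le> B0 * ((2 ^ n) powr (k + e) * \<bar>V t\<bar>)"
      using B0 t nt by (intro mult_left_mono up) auto
    also have "(2 ^ n) powr (k + e) \<le> s powr (k + e)"
      using n e by (intro powr_mono2) auto
    finally show ?thesis using B0 by (simp add: mult.assoc mult_left_mono mult_right_mono)
  qed
  define v where "v = \<bar>V (d / 2)\<bar>"
  have "d / 2 < d4" using d d4(1) unfolding d_def by linarith
  then have v: "0 < v" using d4(2)[of "d / 2"] d by (simp add: v_def)
  define C where "C = max B0 (B0 / v)"
  have C: "0 < C" "B0 \<le> C" "B0 / v \<le> C" using B0 by (auto simp: C_def)
  have "\<bar>V (s * t)\<bar> \<le> C * (s powr (k - e) + s powr (k + e)) * \<bar>V t\<bar>"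
    if t: "0 < t" "t < d / 2" and s: "0 < s" for s t
  proof -
    consider "s < 1" | "1 \<le> s" "s * t < d" | "1 \<le> s" "d \<le> s * t" by linarith
    then show ?thesis
    proof cases
      case 1
      then have "\<bar>V (s * t)\<bar> \<le> B0 * s powr (k - e) * \<bar>V t\<bar>" using small t s d by simp
      also have "\<dots> \<le> C * (s powr (k - e) + s powr (k + e)) * \<bar>V t\<bar>"
        using C B0 by (intro mult_mono) auto
      finally show ?thesis .
    next
      case 2
      then have "\<bar>V (s * t)\<bar> \<le> B0 * s powr (k + e) * \<bar>V t\<bar>" using large t s d by simp
      also have "\<dots> \<le> C * (s powr (k - e) + s powr (k + e)) * \<bar>V t\<bar>"
        using C B0 by (intro mult_mono) auto
      finally show ?thesis .
    next
      case 3
      \<comment> \<open>Here \<open>s * t\<close> is out of reach, and what is needed is that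
        \<open>\<bar>V t\<bar>\<close> is not too small. Comparing \<open>t\<close> with the fixed
        point \<open>d / 2\<close>, where \<open>\<bar>V\<bar>\<close> equals \<open>v > 0\<close>,
        gives this; the multiplier is at least \<open>1\<close> because \<open>t < d / 2\<close>,
        and at most \<open>s\<close>.\<close>
      have "\<bar>V ((d / (2 * t)) * t)\<bar> \<le> B0 * (d / (2 * t)) powr (k + e) * \<bar>V t\<bar>"
        using t d by (intro large) (auto simp: field_simps)
      then have "v \<le> B0 * (d / (2 * t)) powr (k + e) * \<bar>V t\<bar>" using t by (simp add: v_def)
      also have "(d / (2 * t)) powr (k + e) \<le> s powr (k + e)"
        using 3 t d e by (intro powr_mono2) (auto simp: field_simps)
      finally have "v \<le> B0 * s powr (k + e) * \<bar>V t\<bar>"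
        using B0 by (simp add: mult.assoc mult_left_mono mult_right_mono)
      then have "1 \<le> (B0 / v) * s powr (k + e) * \<bar>V t\<bar>" using v by (simp add: field_simps)
      also have "\<dots> \<le> C * (s powr (k - e) + s powr (k + e)) * \<bar>V t\<bar>"
        using C B0 v by (intro mult_mono) auto
      finally show ?thesis using bdd[of "s * t"] by linarith
    qed
  qed
  then show ?thesis using C(1) d by (intro exI[of _ C] conjI exI[of _ "d / 2"]) auto
qed

section \<open>The sine transform and weighted averages of the tail difference\<close>

text \<open>Taylor expansion to fourth order leaves a remainder of size at most
  \<open>s / 24\<close>. It isolates the singular part \<open>1 / (2 * s)\<close> of the kernel,
  whose integral against \<open>sin (s * y)\<close> is a sine integral.\<close>

lemma abs_cos_kernel_diff_le:
  fixes s :: real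
  assumes s: "0 < s" "s \<le> 1"
  shows "\<bar>(1 - cos s) / s ^ 3 - 1 / (2 * s)\<bar> \<le> 1"
proof -
  obtain t where t: "cos s = (\<Sum>m<4. cos_coeff m * s ^ m) + (cos (t + 1/2 * real 4 * pi) / fact 4) * s ^ 4"
    using Maclaurin_cos_expansion[of s 4] by blast
  define c where "c = cos (t + 1/2 * real 4 * pi)"
  have c: "\<bar>c\<bar> \<le> 1" by (simp add: c_def)
  have "cos s = 1 - s\<^sup>2 / 2 + c / 24 * s ^ 4"
    using t unfolding c_def[symmetric] by (simp add: cos_coeff_def lessThan_nat_numeral fact_numeral power2_eq_square)
  then have "1 - cos s = s\<^sup>2 / 2 - c / 24 * s ^ 4" by simp
  then have "(1 - cos s) / s ^ 3 - 1 / (2 * s) = (s\<^sup>2 / 2 - c / 24 * s ^ 4) / s ^ 3 - 1 / (2 * s)"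
    by (simp only:)
  also have "\<dots> = - (c * s / 24)"
    using s by (simp add: field_simps power2_eq_square power3_eq_cube power4_eq_xxxx)
  finally have "(1 - cos s) / s ^ 3 - 1 / (2 * s) = - (c * s / 24)" .
  moreover have "\<bar>c\<bar> * s \<le> 1 * 1" using s c by (intro mult_mono) auto
  ultimately show ?thesis using s by (simp add: abs_mult)
qed

lemma integrable_restrict_sine_kernel:
  assumes "A \<in> sets borel" "A \<subseteq> {0<..}"
  shows "integrable lborel (\<lambda>s. indicator A s * sine_kernel y s)"
  by (rule Bochner_Integration.integrable_bound[OF integrable_sine_kernel[of y]])
     (use assms in \<open>auto simp: indicator_def\<close>)

text \<open>The random variable need not have a logarithmic moment, so the kernel is not absolutely integrable
  against its law near \<open>s = 0\<close>: Fubini applies only after truncation, and this uniform bound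
  removes the truncation.\<close>

lemma truncated_sine_kernel_bounded:
  "\<exists>B. \<forall>d y. 0 < d \<longrightarrow> d \<le> 1 \<longrightarrow> \<bar>\<integral>s. indicator {d..} s * sine_kernel y s \<partial>lborel\<bar> \<le> B"
proof -
  obtain B where B: "\<And>T. \<bar>Si T\<bar> \<le> B" using bounded_Si by blast
  have "\<bar>\<integral>s. indicator {d..} s * sine_kernel y s \<partial>lborel\<bar> \<le> pi + 1 + B" if d: "0 < d" "d \<le> 1" for d y
  proof -
    \<comment> \<open>On \<open>(0, d)\<close> the sine kernel is \<open>?r + ?q / 2\<close>: a
      remainder of integral at most \<open>1\<close> and half a sinc function, whose integral
      \<open>sgn y * Si (d * \<bar>y\<bar>)\<close> is bounded by \<open>B\<close>. The truncated
      integral is the full one minus these two.\<close>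
    let ?r = "\<lambda>s. indicator {0<..<d} s * (sin (s * y) * ((1 - cos s) / s ^ 3 - 1 / (2 * s))) :: real"
    let ?q = "\<lambda>s. indicator {0<..<d} s * (sin (s * y) / s) :: real"
    have q: "integrable lborel ?q" "(\<integral>s. ?q s \<partial>lborel) = sgn y * Si (d * \<bar>y\<bar>)"
      using integrable_sinc'[of d y] LBINT_I0c_sin_scale_divide[of d y] d
      by (simp_all add: interval_lebesgue_integrable_def interval_lebesgue_integral_def zero_ereal_def
          set_integrable_def set_lebesgue_integral_def einterval_eq)
    have ind: "integrable lborel (indicator {0<..<d} :: real \<Rightarrow> real)"
      using d by (intro integrable_real_indicator) (auto simp: emeasure_lborel_Ioo)
    have rle: "norm (?r s) \<le> indicator {0<..<d} s" for s
    proof (cases "s \<in> {0<..<d}")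
      case True
      then have "\<bar>sin (s * y)\<bar> * \<bar>(1 - cos s) / s ^ 3 - 1 / (2 * s)\<bar> \<le> 1 * 1"
        using d by (intro mult_mono abs_cos_kernel_diff_le) auto
      then show ?thesis using True by (simp add: abs_mult)
    qed simp
    have r: "integrable lborel ?r"
      by (rule Bochner_Integration.integrable_bound[OF ind]) (use rle in \<open>auto intro!: AE_I2\<close>)
    have "norm (\<integral>s. ?r s \<partial>lborel) \<le> (\<integral>s. indicator {0<..<d} s \<partial>lborel)"
      using rle by (intro Bochner_Integration.integral_norm_bound_integral r ind)
    also have "\<dots> \<le> 1" using d by simp
    finally have r1: "\<bar>\<integral>s. ?r s \<partial>lborel\<bar> \<le> 1" by simp
    have tr: "integrable lborel (\<lambda>s. indicator {d..} s * sine_kernel y s)"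
      using d by (intro integrable_restrict_sine_kernel) auto
    have "(\<integral>s. indicator {0<..} s * sine_kernel y s \<partial>lborel)
       = (\<integral>s. indicator {d..} s * sine_kernel y s + (?r s + (1/2) * ?q s) \<partial>lborel)"
      by (rule Bochner_Integration.integral_cong) (use d in \<open>auto simp: indicator_def algebra_simps\<close>)
    also have "\<dots> = (\<integral>s. indicator {d..} s * sine_kernel y s \<partial>lborel) + (\<integral>s. ?r s + (1/2) * ?q s \<partial>lborel)"
      by (intro Bochner_Integration.integral_add tr Bochner_Integration.integrable_add integrable_mult_right r q(1))
    also have "(\<integral>s. ?r s + (1/2) * ?q s \<partial>lborel) = (\<integral>s. ?r s \<partial>lborel) + (\<integral>s. (1/2) * ?q s \<partial>lborel)"
      by (intro Bochner_Integration.integral_add integrable_mult_right r q(1))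
    also have "(\<integral>s. (1/2) * ?q s \<partial>lborel) = (1/2) * (\<integral>s. ?q s \<partial>lborel)"
      by (rule integral_mult_right_zero)
    finally have "\<bar>\<integral>s. indicator {d..} s * sine_kernel y s \<partial>lborel\<bar>
      \<le> \<bar>\<integral>s. indicator {0<..} s * sine_kernel y s \<partial>lborel\<bar> + \<bar>\<integral>s. ?r s \<partial>lborel\<bar> + \<bar>\<integral>s. ?q s \<partial>lborel\<bar>"
      by linarith
    \<comment> \<open>The instance at \<open>0\<close> supplies \<open>0 \<le> B\<close>, which
      covers \<open>y = 0\<close>, where \<open>sgn y = 0\<close>.\<close>
    moreover have "\<bar>\<integral>s. ?q s \<partial>lborel\<bar> \<le> B"
      using B[of "d * \<bar>y\<bar>"] B[of 0] unfolding q(2) by (auto simp: abs_mult sgn_real_def)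
    ultimately show ?thesis using r1 abs_integral_sine_kernel_le[of y] by linarith
  qed
  then show ?thesis by blast
qed

section \<open>Averaging the kernel identities over the law of the random variable\<close>

context prob_space
begin

lemma abs_expectation_le_1:
  fixes f :: "'a \<Rightarrow> real"
  assumes "f \<in> borel_measurable M" "\<And>\<omega>. \<bar>f \<omega>\<bar> \<le> 1"
  shows "\<bar>expectation f\<bar> \<le> 1"
proof -
  have f: "f \<omega> \<le> 1" "- 1 \<le> f \<omega>" for \<omega> using assms(2)[of \<omega>] by auto
  have "integrable M f" using assms by (intro integrable_const_bound[where B = 1]) auto
  then have "expectation f \<le> 1" "- 1 \<le> expectation f"
    using f by (auto intro!: integral_le_const integral_ge_const)
  then show ?thesis by simp
qed

lemma abs_sine_transform_le:
  assumes [measurable]: "X \<in> borel_measurable M"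
  shows "\<bar>sine_transform M X t\<bar> \<le> 1"
  unfolding sine_transform_def by (rule abs_expectation_le_1) auto

lemma continuous_on_sine_transform:
  assumes [measurable]: "X \<in> borel_measurable M"
  shows "continuous_on UNIV (sine_transform M X)"
proof (intro continuous_at_imp_continuous_on ballI)
  fix t
  show "isCont (sine_transform M X) t"
    unfolding continuous_at_sequentially comp_def sine_transform_def
  proof (intro allI impI integral_dominated_convergence[where w = "\<lambda>_. 1"])
    fix f :: "nat \<Rightarrow> real" assume "f \<longlonglongrightarrow> t"
    then show "AE \<omega> in M. (\<lambda>n. sin (f n * X \<omega>)) \<longlonglongrightarrow> sin (t * X \<omega>)"
      by (intro AE_I2 tendsto_intros)
  qed auto
qed

lemma expectation_tail_kernel:
  assumes [measurable]: "X \<in> borel_measurable M" and t: "0 < t"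
  shows "(\<integral>\<omega>. tail_kernel u (t * X \<omega>) \<partial>M) = tail_difference M X (u / t)"
proof -
  define a where "a = u / t"
  have int: "integrable M (\<lambda>\<omega>. indicator {\<omega>\<in>space M. P \<omega>} \<omega> :: real)" if "{\<omega>\<in>space M. P \<omega>} \<in> sets M" for P
    using that by (intro integrable_real_indicator) (auto simp: less_top[symmetric])
  have "tail_kernel u (t * X \<omega>) = (indicator {\<omega>\<in>space M. a \<le> X \<omega>} \<omega> + indicator {\<omega>\<in>space M. a < X \<omega>} \<omega>
      - indicator {\<omega>\<in>space M. X \<omega> < - a} \<omega> - indicator {\<omega>\<in>space M. X \<omega> \<le> - a} \<omega>) / 2" if "\<omega> \<in> space M" for \<omega>
  proof -
    have "(u \<le> t * X \<omega>) = (a \<le> X \<omega>)" "(u < t * X \<omega>) = (a < X \<omega>)"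
         "(t * X \<omega> < - u) = (X \<omega> < - a)" "(t * X \<omega> \<le> - u) = (X \<omega> \<le> - a)"
      using t by (auto simp: a_def field_simps)
    then show ?thesis using that by (simp add: tail_kernel_def indicator_def)
  qed
  then have "(\<integral>\<omega>. tail_kernel u (t * X \<omega>) \<partial>M) = (\<integral>\<omega>. (indicator {\<omega>\<in>space M. a \<le> X \<omega>} \<omega> + indicator {\<omega>\<in>space M. a < X \<omega>} \<omega>
      - indicator {\<omega>\<in>space M. X \<omega> < - a} \<omega> - indicator {\<omega>\<in>space M. X \<omega> \<le> - a} \<omega>) / 2 \<partial>M)"
    by (rule Bochner_Integration.integral_cong[OF refl])
  also have "\<dots> = (prob {\<omega>\<in>space M. a \<le> X \<omega>} + prob {\<omega>\<in>space M. a < X \<omega>}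
      - prob {\<omega>\<in>space M. X \<omega> < - a} - prob {\<omega>\<in>space M. X \<omega> \<le> - a}) / 2"
    using int by simp
  also have "prob {\<omega>\<in>space M. a \<le> X \<omega>} = 1 - prob {\<omega>\<in>space M. X \<omega> < a}"
    by (subst prob_neg[symmetric]) (auto simp: not_less)
  also have "prob {\<omega>\<in>space M. a < X \<omega>} = 1 - prob {\<omega>\<in>space M. X \<omega> \<le> a}"
    by (subst prob_neg[symmetric]) (auto simp: not_le)
  finally show ?thesis
    by (simp add: tail_difference_def intermediate_cdf_def a_def field_simps)
qed

lemma tail_difference_eq_expectation:
  assumes "X \<in> borel_measurable M"
  shows "tail_difference M X u = (\<integral>\<omega>. tail_kernel u (X \<omega>) \<partial>M)"
  using expectation_tail_kernel[OF assms, of 1 u] by simp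

lemma borel_measurable_tail_difference:
  assumes [measurable]: "X \<in> borel_measurable M"
  shows "tail_difference M X \<in> borel_measurable borel"
  unfolding tail_difference_eq_expectation[OF assms, abs_def] by measurable

lemma abs_tail_difference_le:
  assumes [measurable]: "X \<in> borel_measurable M"
  shows "\<bar>tail_difference M X u\<bar> \<le> 1"
  unfolding tail_difference_eq_expectation[OF assms]
  by (rule abs_expectation_le_1) (auto simp: abs_tail_kernel_le)

text \<open>With \<open>s\<close> restricted to \<open>s \<ge> d n\<close>, expectation and integral
  can be exchanged. As \<open>d n\<close> tends to \<open>0\<close>, the expectation side converges
  by the uniform bound \<open>B\<close>, and the transform side by the assumed integrability, which
  concerns \<open>V\<close> and not the law itself. A second exchange then turns the tail kernel
  into the tail difference.\<close>

lemma integral_sine_transform_kernel: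
  assumes X [measurable]: "X \<in> borel_measurable M" and t: "0 < t"
    and int: "integrable lborel (\<lambda>s. indicator {0<..} s * (sine_transform M X (s * t) * ((1 - cos s) / s ^ 3)))"
  shows "(\<integral>s. indicator {0<..} s * (sine_transform M X (s * t) * ((1 - cos s) / s ^ 3)) \<partial>lborel)
     = pi / 2 * (\<integral>u. triangle u * tail_difference M X (u / t) \<partial>lborel)"
proof -
  interpret pair_sigma_finite M lborel ..
  define d where "d = (\<lambda>n::nat. 1 / (real n + 1))"
  have d: "0 < d n" "d n \<le> 1" for n by (auto simp: d_def)
  have d0: "d \<longlonglongrightarrow> 0" unfolding d_def by real_asymp
  have ind: "(\<lambda>n. indicator {d n..} s * c) \<longlonglongrightarrow> indicator {0<..} s * c" for s c :: real
  proof (cases "0 < s")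
    case True
    have "\<forall>\<^sub>F n in sequentially. d n < s" using order_tendstoD(2)[OF d0 True] .
    then have "\<forall>\<^sub>F n in sequentially. indicator {0<..} s * c = indicator {d n..} s * c"
      by eventually_elim (use True in auto)
    then show ?thesis by (rule Lim_transform_eventually[rotated]) simp
  next
    case False
    then have "indicator {d n..} s = (0::real)" for n using d(1)[of n] by (auto simp: indicator_def)
    then show ?thesis using False by simp
  qed
  note [measurable] = borel_measurable_continuous_onI[OF continuous_on_sine_transform[OF X]]
  obtain B where B: "\<And>d y. 0 < d \<Longrightarrow> d \<le> 1 \<Longrightarrow> \<bar>\<integral>s. indicator {d..} s * sine_kernel y s \<partial>lborel\<bar> \<le> B"
    using truncated_sine_kernel_bounded by blast
  have "(\<lambda>n. \<integral>\<omega>. (\<integral>s. indicator {d n..} s * sine_kernel (t * X \<omega>) s \<partial>lborel) \<partial>M)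
      \<longlonglongrightarrow> (\<integral>\<omega>. (\<integral>s. indicator {0<..} s * sine_kernel (t * X \<omega>) s \<partial>lborel) \<partial>M)"
  proof (rule integral_dominated_convergence[where w = "\<lambda>_. B"])
    show "AE \<omega> in M. (\<lambda>n. \<integral>s. indicator {d n..} s * sine_kernel (t * X \<omega>) s \<partial>lborel)
      \<longlonglongrightarrow> (\<integral>s. indicator {0<..} s * sine_kernel (t * X \<omega>) s \<partial>lborel)"
    proof (intro AE_I2)
      fix \<omega>
      show "(\<lambda>n. \<integral>s. indicator {d n..} s * sine_kernel (t * X \<omega>) s \<partial>lborel)
        \<longlonglongrightarrow> (\<integral>s. indicator {0<..} s * sine_kernel (t * X \<omega>) s \<partial>lborel)"
      proof (rule integral_dominated_convergence)
        show "integrable lborel (\<lambda>s. norm (indicator {0<..} s * sine_kernel (t * X \<omega>) s))"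
          using integrable_sine_kernel by (rule integrable_norm)
        show "AE s in lborel. norm (indicator {d n..} s * sine_kernel (t * X \<omega>) s)
          \<le> norm (indicator {0<..} s * sine_kernel (t * X \<omega>) s)" for n
          using d(1)[of n] by (intro AE_I2) (auto simp: indicator_def)
        show "AE s in lborel. (\<lambda>n. indicator {d n..} s * sine_kernel (t * X \<omega>) s)
          \<longlonglongrightarrow> indicator {0<..} s * sine_kernel (t * X \<omega>) s"
          by (intro AE_I2 ind)
      qed measurable
    qed
    show "AE \<omega> in M. norm (\<integral>s. indicator {d n..} s * sine_kernel (t * X \<omega>) s \<partial>lborel) \<le> B" for n
      using B[OF d, of n] by auto
    show "(\<lambda>\<omega>. \<integral>s. indicator {0<..} s * sine_kernel (t * X \<omega>) s \<partial>lborel) \<in> borel_measurable M"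
      by (rule lborel.borel_measurable_lebesgue_integral) measurable
    show "(\<lambda>\<omega>. \<integral>s. indicator {d n..} s * sine_kernel (t * X \<omega>) s \<partial>lborel) \<in> borel_measurable M" for n
      by (rule lborel.borel_measurable_lebesgue_integral) measurable
  qed simp
  moreover have "(\<integral>\<omega>. (\<integral>s. indicator {d n..} s * sine_kernel (t * X \<omega>) s \<partial>lborel) \<partial>M)
      = (\<integral>s. indicator {d n..} s * (sine_transform M X (s * t) * ((1 - cos s) / s ^ 3)) \<partial>lborel)" for n
  proof -
    have "(\<integral>\<omega>. (\<integral>s. indicator {d n..} s * sine_kernel (t * X \<omega>) s \<partial>lborel) \<partial>M)
        = (\<integral>s. (\<integral>\<omega>. indicator {d n..} s * sine_kernel (t * X \<omega>) s \<partial>M) \<partial>lborel)"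
    proof (rule Fubini_integral[symmetric], rule integrable_bounded_by_product)
      \<comment> \<open>For \<open>s \<ge> d n\<close>, bounding the sine by \<open>1\<close> costs
        only a factor \<open>1 / s \<le> 1 / d n\<close>, which does not depend on the
        outcome.\<close>
      show "integrable M (\<lambda>_. 1 / d n :: real)" by simp
      show "integrable lborel (\<lambda>s. indicator {0<..} s * ((1 - cos (1 * s)) / s\<^sup>2) :: real)"
        using has_bochner_integral_1_minus_cos_scale[of 1] by (simp only: has_bochner_integral_iff)
      fix \<omega> s
      show "\<bar>case (\<omega>, s) of (\<omega>, s) \<Rightarrow> indicator {d n..} s * sine_kernel (t * X \<omega>) s\<bar>
         \<le> 1 / d n * (indicator {0<..} s * ((1 - cos (1 * s)) / s\<^sup>2))"
      proof (cases "d n \<le> s")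
        case True
        then have s: "0 < s" using d(1)[of n] by linarith
        have "\<bar>sin (s * (t * X \<omega>))\<bar> * ((1 - cos s) / s ^ 3) \<le> 1 * ((1 - cos s) / s ^ 3)"
          using s by (intro mult_right_mono) auto
        also have "\<dots> = (1 / s) * ((1 - cos s) / s\<^sup>2)" using s by (simp add: power2_eq_square power3_eq_cube)
        also have "\<dots> \<le> (1 / d n) * ((1 - cos s) / s\<^sup>2)"
          using True d(1)[of n] s by (intro mult_right_mono divide_left_mono) auto
        finally show ?thesis using True s by (simp add: abs_mult)
      next
        case False
        then show ?thesis using d(1)[of n] by simp
      qed
    qed measurable
    also have "\<dots> = (\<integral>s. indicator {d n..} s * (sine_transform M X (s * t) * ((1 - cos s) / s ^ 3)) \<partial>lborel)"
      by (intro Bochner_Integration.integral_cong refl)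
         (simp add: sine_transform_def mult.assoc)
    finally show ?thesis .
  qed
  moreover have "(\<lambda>n. \<integral>s. indicator {d n..} s * (sine_transform M X (s * t) * ((1 - cos s) / s ^ 3)) \<partial>lborel)
      \<longlonglongrightarrow> (\<integral>s. indicator {0<..} s * (sine_transform M X (s * t) * ((1 - cos s) / s ^ 3)) \<partial>lborel)"
  proof (rule integral_dominated_convergence[OF _ _ integrable_norm[OF int]])
    show "AE s in lborel. norm (indicator {d n..} s * (sine_transform M X (s * t) * ((1 - cos s) / s ^ 3)))
      \<le> norm (indicator {0<..} s * (sine_transform M X (s * t) * ((1 - cos s) / s ^ 3)))" for n
      using d(1)[of n] by (intro AE_I2) (auto simp: indicator_def)
    show "AE s in lborel. (\<lambda>n. indicator {d n..} s * (sine_transform M X (s * t) * ((1 - cos s) / s ^ 3)))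
      \<longlonglongrightarrow> indicator {0<..} s * (sine_transform M X (s * t) * ((1 - cos s) / s ^ 3))"
      by (intro AE_I2 ind)
  qed measurable
  ultimately have "(\<integral>s. indicator {0<..} s * (sine_transform M X (s * t) * ((1 - cos s) / s ^ 3)) \<partial>lborel)
     = (\<integral>\<omega>. (\<integral>s. indicator {0<..} s * sine_kernel (t * X \<omega>) s \<partial>lborel) \<partial>M)"
    by (simp add: LIMSEQ_unique)
  also have "\<dots> = pi / 2 * (\<integral>\<omega>. (\<integral>u. triangle u * tail_kernel u (t * X \<omega>) \<partial>lborel) \<partial>M)"
    unfolding integral_sine_kernel by simp
  also have "(\<integral>\<omega>. (\<integral>u. triangle u * tail_kernel u (t * X \<omega>) \<partial>lborel) \<partial>M)
     = (\<integral>u. (\<integral>\<omega>. triangle u * tail_kernel u (t * X \<omega>) \<partial>M) \<partial>lborel)"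
  proof (rule Fubini_integral[symmetric], rule integrable_bounded_by_product)
    show "integrable M (\<lambda>_. 1 :: real)" by simp
    show "integrable lborel triangle"
      using has_bochner_integral_triangle by (simp add: has_bochner_integral_iff)
    show "\<bar>case (\<omega>, u) of (\<omega>, u) \<Rightarrow> triangle u * tail_kernel u (t * X \<omega>)\<bar> \<le> 1 * triangle u" for \<omega> u
      by (simp add: abs_mult triangle_nonneg abs_tail_kernel_le mult_left_le)
  qed measurable
  also have "\<dots> = (\<integral>u. triangle u * tail_difference M X (u / t) \<partial>lborel)"
    by (simp add: expectation_tail_kernel[OF X t])
  finally show ?thesis .
qed

end

section \<open>From averages to the tail difference\<close>

text \<open>For \<open>x > 0\<close>, the quantity \<open>x^2 * triangle_average K x\<close> is the
  integral of \<open>(x - y) * K y\<close> over \<open>y\<close> in \<open>[0, x]\<close>, that is,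
  the double integral of \<open>K\<close> from \<open>0\<close>.\<close>

definition triangle_average :: "(real \<Rightarrow> real) \<Rightarrow> real \<Rightarrow> real" where
  "triangle_average K x = (\<integral>u. triangle u * K (u * x) \<partial>lborel)"

text \<open>The Potter bound with \<open>t = 1 / x\<close> plays two parts: it provides the
  integrability required by the exact formula, and the majorant \<open>D\<close> for passing to the
  limit \<open>s powr k\<close> in \<open>V (s / x) / V (1 / x)\<close>.\<close>

lemma tendsto_triangle_average_tail_difference:
  assumes "prob_space M" and X [measurable]: "X \<in> borel_measurable M"
    and k: "0 < k" "k < 2" and rv: "regularly_varying_at_0 (sine_transform M X) k"
  shows "((\<lambda>x. triangle_average (tail_difference M X) x / sine_transform M X (1 / x))
    \<longlongrightarrow> 1 / (Gamma (3 - k) * sin (pi / 2 * k))) at_top"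
proof -
  interpret prob_space M by fact
  define V where "V = sine_transform M X"
  let ?w = "\<lambda>s::real. (1 - cos s) / s ^ 3"
  have cont: "continuous_on UNIV V" unfolding V_def by (rule continuous_on_sine_transform) fact
  note [measurable] = borel_measurable_continuous_onI[OF cont]
  \<comment> \<open>Half the distance from \<open>k\<close> to the nearer end of
    \<open>(0, 2)\<close>, so that both exponents \<open>k - e\<close> and \<open>k + e\<close> stay
    inside the range where the kernel integral converges.\<close>
  define e where "e = min k (2 - k) / 2"
  have e: "0 < e" "e < k" "k + e < 2" using k by (auto simp: e_def min_def field_simps)
  obtain C d1 where C: "0 < C" and d1: "0 < d1"
    "\<And>t s. 0 < t \<Longrightarrow> t < d1 \<Longrightarrow> 0 < s \<Longrightarrow> \<bar>V (s * t)\<bar> \<le> C * (s powr (k - e) + s powr (k + e)) * \<bar>V t\<bar>"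
    using Potter_bound[OF cont rv[folded V_def] _ e(1,2)] abs_sine_transform_le[OF X]
    unfolding V_def by blast
  obtain d2 where d2: "0 < d2" "\<And>t. 0 < t \<Longrightarrow> t < d2 \<Longrightarrow> V t \<noteq> 0"
    using regularly_varying_at_0_nonzero[OF rv] unfolding V_def by blast
  define D where "D = (\<lambda>s. C * (indicator {0<..} s * ((1 - cos s) * s powr ((k - e) - 3))
      + indicator {0<..} s * ((1 - cos s) * s powr ((k + e) - 3))))"
  have D: "integrable lborel D"
    unfolding D_def using has_bochner_integral_1_minus_cos_powr[of "k - e"]
      has_bochner_integral_1_minus_cos_powr[of "k + e"] e k
    by (intro integrable_mult_right Bochner_Integration.integrable_add) (auto simp: has_bochner_integral_iff)
  have powr3: "s powr a * ?w s = (1 - cos s) * s powr (a - 3)" if "0 < s" for s a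
    using that by (simp add: powr_diff)
  have le: "\<bar>indicator {0<..} s * (V (s * t) * ?w s)\<bar> \<le> \<bar>V t\<bar> * D s" if t: "0 < t" "t < d1" for s t
  proof (cases "0 < s")
    case True
    have "\<bar>V (s * t)\<bar> * ?w s \<le> C * (s powr (k - e) + s powr (k + e)) * \<bar>V t\<bar> * ?w s"
      using True t by (intro mult_right_mono d1(2)) auto
    also have "\<dots> = \<bar>V t\<bar> * (C * (s powr (k - e) * ?w s + s powr (k + e) * ?w s))"
      by (simp add: algebra_simps add_divide_distrib)
    also have "\<dots> = \<bar>V t\<bar> * D s"
      unfolding D_def powr3[OF True] using True by simp
    finally show ?thesis using True by (simp add: abs_mult)
  qed (simp add: D_def)
  have avg: "triangle_average (tail_difference M X) x =
      2 / pi * (\<integral>s. indicator {0<..} s * (V (s * (1 / x)) * ?w s) \<partial>lborel)" if x: "0 < x" "1 / x < d1" for x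
  proof -
    have "integrable lborel (\<lambda>s. indicator {0<..} s * (V (s * (1 / x)) * ?w s))"
    proof (rule Bochner_Integration.integrable_bound)
      show "integrable lborel (\<lambda>s. \<bar>V (1 / x)\<bar> * D s)" using D by (rule integrable_mult_right)
      show "AE s in lborel. norm (indicator {0<..} s * (V (s * (1 / x)) * ?w s)) \<le> norm (\<bar>V (1 / x)\<bar> * D s)"
        using le[of "1 / x"] x by (intro AE_I2) (smt (verit) real_norm_def zero_less_divide_1_iff)
    qed measurable
    from integral_sine_transform_kernel[OF X _ this[unfolded V_def]] x(1)
    have "(\<integral>s. indicator {0<..} s * (V (s * (1 / x)) * ?w s) \<partial>lborel)
        = pi / 2 * triangle_average (tail_difference M X) x"
      by (simp add: V_def triangle_average_def)
    then show ?thesis by (simp only:) simp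
  qed
  have inv: "filterlim (\<lambda>x::real. 1 / x) (at_right 0) at_top" by real_asymp
  have ev: "\<forall>\<^sub>F x in at_top. 0 < x \<and> 1 / x < d1 \<and> 1 / x < d2"
  proof -
    have "\<forall>\<^sub>F t in at_right 0. t < d1 \<and> t < d2"
      using d1(1) d2(1) unfolding eventually_at_right_field by (intro exI[of _ "min d1 d2"]) auto
    from eventually_compose_filterlim[OF this inv] eventually_gt_at_top[of 0]
    show ?thesis by eventually_elim auto
  qed
  have "((\<lambda>x. \<integral>s. indicator {0<..} s * (V (s * (1 / x)) / V (1 / x) * ?w s) \<partial>lborel)
      \<longlongrightarrow> (\<integral>s. indicator {0<..} s * (s powr k * ?w s) \<partial>lborel)) at_top"
  proof (rule integral_dominated_convergence_at_top[where w = D])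
    show "AE s in lborel. ((\<lambda>x. indicator {0<..} s * (V (s * (1 / x)) / V (1 / x) * ?w s))
        \<longlongrightarrow> indicator {0<..} s * (s powr k * ?w s)) at_top"
    proof (intro AE_I2)
      fix s
      show "((\<lambda>x. indicator {0<..} s * (V (s * (1 / x)) / V (1 / x) * ?w s))
        \<longlongrightarrow> indicator {0<..} s * (s powr k * ?w s)) at_top"
      proof (cases "0 < s")
        case True
        then have "((\<lambda>t. V (s * t) / V t) \<longlongrightarrow> s powr k) (at_right 0)"
          using rv unfolding V_def regularly_varying_at_0_def by blast
        from filterlim_compose[OF this inv] show ?thesis
          by (intro tendsto_mult tendsto_const)
      qed simp
    qed
    show "\<forall>\<^sub>F x in at_top. AE s in lborel. norm (indicator {0<..} s * (V (s * (1 / x)) / V (1 / x) * ?w s)) \<le> D s"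
      using ev
    proof eventually_elim
      case (elim x)
      have v: "0 < \<bar>V (1 / x)\<bar>" using d2(2)[of "1 / x"] elim by simp
      have "norm (indicator {0<..} s * (V (s * (1 / x)) / V (1 / x) * ?w s)) =
          \<bar>indicator {0<..} s * (V (s * (1 / x)) * ?w s)\<bar> / \<bar>V (1 / x)\<bar>" for s
        by (simp add: abs_mult)
      also have "\<dots> s \<le> D s" for s
        using le[of "1 / x" s] elim v by (simp only: pos_divide_le_eq) (simp add: mult.commute)
      finally show ?case by simp
    qed
  qed (use D in measurable)
  also have "(\<integral>s. indicator {0<..} s * (s powr k * ?w s) \<partial>lborel) = pi / (2 * Gamma (3 - k) * sin (pi / 2 * k))"
  proof -
    have "(\<integral>s. indicator {0<..} s * (s powr k * ?w s) \<partial>lborel) = (\<integral>s. indicator {0<..} s * ((1 - cos s) * s powr (k - 3)) \<partial>lborel)"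
      by (rule Bochner_Integration.integral_cong) (use powr3 in \<open>auto simp: indicator_def\<close>)
    then show ?thesis using has_bochner_integral_1_minus_cos_powr[OF k] by (simp only: has_bochner_integral_iff)
  qed
  finally have "((\<lambda>x. 2 / pi * (\<integral>s. indicator {0<..} s * (V (s * (1 / x)) / V (1 / x) * ?w s) \<partial>lborel))
      \<longlongrightarrow> 2 / pi * (pi / (2 * Gamma (3 - k) * sin (pi / 2 * k)))) at_top"
    by (intro tendsto_mult tendsto_const)
  moreover have "\<forall>\<^sub>F x in at_top. 2 / pi * (\<integral>s. indicator {0<..} s * (V (s * (1 / x)) / V (1 / x) * ?w s) \<partial>lborel)
      = triangle_average (tail_difference M X) x / V (1 / x)"
    using ev
  proof eventually_elim
    case (elim x)
    have "(\<integral>s. indicator {0<..} s * (V (s * (1 / x)) / V (1 / x) * ?w s) \<partial>lborel)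
      = (\<integral>s. indicator {0<..} s * (V (s * (1 / x)) * ?w s) * (1 / V (1 / x)) \<partial>lborel)"
      by (rule Bochner_Integration.integral_cong) auto
    also have "\<dots> = (\<integral>s. indicator {0<..} s * (V (s * (1 / x)) * ?w s) \<partial>lborel) * (1 / V (1 / x))"
      by (rule integral_mult_left_zero)
    finally show ?case using avg[of x] elim by simp
  qed
  ultimately have "((\<lambda>x. triangle_average (tail_difference M X) x / V (1 / x))
      \<longlongrightarrow> 2 / pi * (pi / (2 * Gamma (3 - k) * sin (pi / 2 * k)))) at_top"
    by (rule Lim_transform_eventually)
  then show ?thesis by (simp add: V_def)
qed

text \<open>Substitute \<open>u = l * v\<close>. For \<open>u > 0\<close> the rescaled weight
  \<open>l * triangle (u / l)\<close> is \<open>max 0 (l - u)\<close>, which is piecewise linear in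
  \<open>l\<close>, so its second differences in \<open>l\<close> have compact support in
  \<open>u\<close>.\<close>

lemma has_bochner_integral_triangle_scale:
  assumes l: "0 < l" and K [measurable]: "K \<in> borel_measurable borel" and bdd: "\<And>u. \<bar>K u\<bar> \<le> 1"
  shows "has_bochner_integral lborel (\<lambda>u. l * triangle (u / l) * K (u * x)) (l\<^sup>2 * triangle_average K (l * x))"
proof -
  have tri: "integrable lborel triangle"
    using has_bochner_integral_triangle by (simp add: has_bochner_integral_iff)
  have "integrable lborel (\<lambda>v. triangle v * K (v * (l * x)))"
  proof (rule Bochner_Integration.integrable_bound[OF tri])
    show "AE v in lborel. norm (triangle v * K (v * (l * x))) \<le> norm (triangle v)"
      using bdd by (intro AE_I2) (simp add: abs_mult mult_left_le)
  qed measurable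
  then have "has_bochner_integral lborel (\<lambda>v. triangle v * K (v * (l * x))) (triangle_average K (l * x))"
    by (simp add: has_bochner_integral_iff triangle_average_def)
  then have "has_bochner_integral lborel (\<lambda>v. l * (triangle v * K (v * (l * x)))) (l * triangle_average K (l * x))"
    by (rule has_bochner_integral_mult_right)
  moreover have "(l\<^sup>2 * triangle_average K (l * x)) /\<^sub>R \<bar>l\<bar> = l * triangle_average K (l * x)"
    using l by (simp add: power2_eq_square)
  moreover have "(\<lambda>v. l * triangle ((0 + l * v) / l) * K ((0 + l * v) * x)) =
      (\<lambda>v. l * (triangle v * K (v * (l * x))))"
    using l by (simp add: mult_ac)
  ultimately have "has_bochner_integral lborel (\<lambda>v. l * triangle ((0 + l * v) / l) * K ((0 + l * v) * x))
      ((l\<^sup>2 * triangle_average K (l * x)) /\<^sub>R \<bar>l\<bar>)"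
    by (simp only:)
  then show ?thesis
    by (rule iffD2[OF lborel_has_bochner_integral_real_affine_iff[where c = l and t = 0], rotated])
       (use l in simp)
qed

text \<open>The second difference of \<open>\<lambda>l. l * triangle (u / l)\<close> at \<open>l = 1, 1 + h, 1 + 2 * h\<close>
  is a tent of mass \<open>h\<^sup>2\<close> over \<open>[1, 1 + 2 * h]\<close>.\<close>

lemma triangle_average_second_difference_bounds:
  assumes h: "0 < h" and K [measurable]: "K \<in> borel_measurable borel" and bdd: "\<And>u. \<bar>K u\<bar> \<le> 1"
    and anti: "antimono_on {a..} K" and x: "0 < x" "a \<le> x"
  defines "S \<equiv> (1 + 2 * h)\<^sup>2 * triangle_average K ((1 + 2 * h) * x)
    - 2 * ((1 + h)\<^sup>2 * triangle_average K ((1 + h) * x)) + triangle_average K x"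
  shows "h\<^sup>2 * K ((1 + 2 * h) * x) \<le> S" "S \<le> h\<^sup>2 * K x"
proof -
  define T where "T = (\<lambda>u. (1 + 2 * h) * triangle (u / (1 + 2 * h)) - 2 * ((1 + h) * triangle (u / (1 + h))) + triangle u)"
  have scale: "l * triangle (u / l) = (if 0 < u then max 0 (l - u) else 0)" if "0 < l" for l u
    using that by (auto simp: triangle_def indicator_def max_def field_simps zero_less_divide_iff)
  have T: "T u = (if 0 < u then max 0 (1 + 2 * h - u) - 2 * max 0 (1 + h - u) + max 0 (1 - u) else 0)" for u
    unfolding T_def using scale[of "1 + 2 * h" u] scale[of "1 + h" u] scale[of 1 u] h by auto
  \<comment> \<open>Nonnegativity is the convexity of \<open>max 0 (l - u)\<close> in
    \<open>l\<close>.\<close>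
  have T_nonneg: "0 \<le> T u" for u unfolding T using h by (auto simp: max_def)
  have T_supp: "1 \<le> u \<and> u \<le> 1 + 2 * h" if "T u \<noteq> 0" for u
    using that h unfolding T by (auto simp: max_def split: if_splits)
  have hb: "has_bochner_integral lborel (\<lambda>u. T u * L (u * x))
     ((1 + 2 * h)\<^sup>2 * triangle_average L ((1 + 2 * h) * x)
    - 2 * ((1 + h)\<^sup>2 * triangle_average L ((1 + h) * x)) + triangle_average L x)"
    if "L \<in> borel_measurable borel" "\<And>u. \<bar>L u\<bar> \<le> 1" for L
  proof -
    have "has_bochner_integral lborel (\<lambda>u. (1 + 2 * h) * triangle (u / (1 + 2 * h)) * L (u * x)
        - 2 * ((1 + h) * triangle (u / (1 + h)) * L (u * x)) + 1 * triangle (u / 1) * L (u * x))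
     ((1 + 2 * h)\<^sup>2 * triangle_average L ((1 + 2 * h) * x)
      - 2 * ((1 + h)\<^sup>2 * triangle_average L ((1 + h) * x)) + 1\<^sup>2 * triangle_average L (1 * x))"
      using h that by (intro has_bochner_integral_add has_bochner_integral_diff
          has_bochner_integral_mult_right has_bochner_integral_triangle_scale) auto
    then show ?thesis by (simp add: T_def algebra_simps)
  qed
  \<comment> \<open>The mass of \<open>T\<close> comes from the same second-difference formula
    applied to the constant function \<open>1\<close>, whose average is \<open>1/2\<close>.\<close>
  have one: "triangle_average (\<lambda>_. 1) y = 1 / 2" for y
    using has_bochner_integral_triangle by (simp add: triangle_average_def has_bochner_integral_iff)
  have "(1 + 2 * h)\<^sup>2 * (1 / 2) - 2 * ((1 + h)\<^sup>2 * (1 / 2)) + 1 / 2 = h\<^sup>2"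
    by (simp add: power2_eq_square field_simps)
  then have T_int: "has_bochner_integral lborel T (h\<^sup>2)"
    using hb[of "\<lambda>_. 1"] by (simp add: one)
  have TK: "integrable lborel (\<lambda>u. T u * K (u * x))" "(\<integral>u. T u * K (u * x) \<partial>lborel) = S"
    using hb[OF K bdd] by (simp_all add: has_bochner_integral_iff S_def)
  have Tc: "integrable lborel (\<lambda>u. T u * c)" "(\<integral>u. T u * c \<partial>lborel) = h\<^sup>2 * c" for c
    using T_int by (simp_all add: has_bochner_integral_iff)
  \<comment> \<open>On the support of \<open>T\<close> the point \<open>u * x\<close> lies between
    \<open>x\<close> and \<open>(1 + 2 * h) * x\<close>, so the antitone \<open>K\<close> is
    squeezed between its values at the two ends.\<close>
  have K_le: "T u * K (u * x) \<le> T u * K x" "T u * K ((1 + 2 * h) * x) \<le> T u * K (u * x)" for u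
  proof -
    have "T u * K (u * x) \<le> T u * K x \<and> T u * K ((1 + 2 * h) * x) \<le> T u * K (u * x)"
    proof (cases "T u = 0")
      case False
      with T_supp have u: "1 \<le> u" "u \<le> 1 + 2 * h" by auto
      have "x \<le> u * x" "u * x \<le> (1 + 2 * h) * x"
        using u x(1) mult_right_mono[of 1 u x] mult_right_mono[of u "1 + 2 * h" x] by auto
      then have "K (u * x) \<le> K x" "K ((1 + 2 * h) * x) \<le> K (u * x)"
        using x(2) by (auto intro!: monotone_onD[OF anti])
      then show ?thesis using T_nonneg[of u] by (simp add: mult_left_mono)
    qed simp
    then show "T u * K (u * x) \<le> T u * K x" "T u * K ((1 + 2 * h) * x) \<le> T u * K (u * x)" by auto
  qed
  show "h\<^sup>2 * K ((1 + 2 * h) * x) \<le> S"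
    unfolding TK(2)[symmetric] Tc(2)[symmetric] by (rule integral_mono[OF Tc(1) TK(1) K_le(2)])
  show "S \<le> h\<^sup>2 * K x"
    unfolding TK(2)[symmetric] Tc(2)[symmetric] by (rule integral_mono[OF TK(1) Tc(1) K_le(1)])
qed

text \<open>The limit is the second derivative of \<open>y powr p\<close> at \<open>y = 1\<close>.
  After one use of l'Hopital, \<open>f h / h\<close> is a difference quotient of \<open>f\<close> at
  \<open>0\<close>, where \<open>f\<close> vanishes and has derivative
  \<open>2 * (p - 1) - (p - 1)\<close>.\<close>

lemma tendsto_powr_second_difference:
  fixes p :: real
  shows "((\<lambda>h. ((1 + 2 * h) powr p - 2 * (1 + h) powr p + 1) / h\<^sup>2) \<longlongrightarrow> p * (p - 1)) (at_right 0)"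
proof (rule lhopital_right)
  define f where "f = (\<lambda>h::real. (1 + 2 * h) powr (p - 1) - (1 + h) powr (p - 1))"
  have pos: "\<forall>\<^sub>F h::real in at_right 0. 0 < h" by (rule eventually_at_right_less)
  show "((\<lambda>h. (1 + 2 * h) powr p - 2 * (1 + h) powr p + 1) \<longlongrightarrow> 0) (at_right 0)"
    by (auto intro!: tendsto_eq_intros)
  show "((\<lambda>h::real. h\<^sup>2) \<longlongrightarrow> 0) (at_right 0)"
    by (auto intro!: tendsto_eq_intros)
  show "\<forall>\<^sub>F h::real in at_right 0. h\<^sup>2 \<noteq> 0" "\<forall>\<^sub>F h::real in at_right 0. 2 * h \<noteq> 0"
    using pos by (eventually_elim, simp)+
  show "\<forall>\<^sub>F h in at_right 0. ((\<lambda>h. (1 + 2 * h) powr p - 2 * (1 + h) powr p + 1) has_real_derivative 2 * p * f h) (at h)"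
    using pos
    by eventually_elim (auto intro!: derivative_eq_intros simp: f_def algebra_simps)
  show "\<forall>\<^sub>F h::real in at_right 0. ((\<lambda>h. h\<^sup>2) has_real_derivative 2 * h) (at h)"
    by (auto intro!: always_eventually derivative_eq_intros)
  have "(f has_real_derivative (p - 1)) (at 0)"
    unfolding f_def by (auto intro!: derivative_eq_intros)
  then have "((\<lambda>h. f h / h) \<longlongrightarrow> p - 1) (at 0)"
    by (simp add: has_field_derivative_iff f_def)
  then have "((\<lambda>h. f h / h) \<longlongrightarrow> p - 1) (at_right 0)"
    by (rule tendsto_mono[rotated]) (rule at_le, simp)
  from tendsto_mult[OF tendsto_const[of p] this]
  show "((\<lambda>h. 2 * p * f h / (2 * h)) \<longlongrightarrow> p * (p - 1)) (at_right 0)" by simp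
qed

text \<open>A monotone density argument at the level of second differences. A tent starting at
  \<open>x\<close> bounds \<open>K x\<close> from below, and a tent ending at \<open>x\<close>
  bounds it from above. The index is \<open>- k\<close> because \<open>v x\<close> stands for
  \<open>V (1 / x)\<close>, so \<open>x^2 * v x\<close> varies with index
  \<open>2 - k\<close>.\<close>

lemma tendsto_of_triangle_average:
  fixes K v :: "real \<Rightarrow> real" and k m :: real
  assumes K: "K \<in> borel_measurable borel" and bdd: "\<And>u. \<bar>K u\<bar> \<le> 1"
    and anti: "antimono_on {a..} K"
    and pos: "\<forall>\<^sub>F x in at_top. 0 < v x"
    and rv: "\<And>l. 0 < l \<Longrightarrow> ((\<lambda>x. v (l * x) / v x) \<longlongrightarrow> l powr (- k)) at_top"
    and avg: "((\<lambda>x. triangle_average K x / v x) \<longlongrightarrow> m) at_top"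
  shows "((\<lambda>x. K x / v x) \<longlongrightarrow> m * ((2 - k) * (1 - k))) at_top"
proof -
  define c where "c = (\<lambda>h. m * ((1 + 2 * h) powr (2 - k) - 2 * (1 + h) powr (2 - k) + 1))"
  define S where "S = (\<lambda>h x. (1 + 2 * h)\<^sup>2 * triangle_average K ((1 + 2 * h) * x)
    - 2 * ((1 + h)\<^sup>2 * triangle_average K ((1 + h) * x)) + triangle_average K x)"
  have mult_top: "filterlim (\<lambda>x. l * x) at_top at_top" if "0 < l" for l :: real
    using that by (rule filterlim_tendsto_pos_mult_at_top[OF tendsto_const _ filterlim_ident])
  have scale: "((\<lambda>x. l\<^sup>2 * triangle_average K (l * x) / v x) \<longlongrightarrow> m * l powr (2 - k)) at_top" if l: "0 < l" for l
  proof -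
    have lim: "((\<lambda>x. l\<^sup>2 * (triangle_average K (l * x) / v (l * x) * (v (l * x) / v x)))
        \<longlongrightarrow> l\<^sup>2 * (m * l powr (- k))) at_top"
      by (intro tendsto_mult tendsto_const rv l filterlim_compose[OF avg mult_top])
    have eq: "l\<^sup>2 * (m * l powr (- k)) = m * l powr (2 - k)"
      using l by (simp add: powr_diff powr_minus_divide)
    have "\<forall>\<^sub>F x in at_top. l\<^sup>2 * (triangle_average K (l * x) / v (l * x) * (v (l * x) / v x))
        = l\<^sup>2 * triangle_average K (l * x) / v x"
      using eventually_compose_filterlim[OF pos mult_top[OF l]] by eventually_elim simp
    from Lim_transform_eventually[OF lim this] show ?thesis by (simp only: eq)
  qed
  have S_lim: "((\<lambda>x. S h x / v x) \<longlongrightarrow> c h) at_top" if h: "0 < h" for h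
  proof -
    have "((\<lambda>x. (1 + 2 * h)\<^sup>2 * triangle_average K ((1 + 2 * h) * x) / v x
        - 2 * ((1 + h)\<^sup>2 * triangle_average K ((1 + h) * x) / v x) + triangle_average K x / v x)
        \<longlongrightarrow> m * (1 + 2 * h) powr (2 - k) - 2 * (m * (1 + h) powr (2 - k)) + m) at_top"
      using h by (intro tendsto_add tendsto_diff tendsto_mult tendsto_const scale avg) auto
    moreover have "S h x / v x = (1 + 2 * h)\<^sup>2 * triangle_average K ((1 + 2 * h) * x) / v x
        - 2 * ((1 + h)\<^sup>2 * triangle_average K ((1 + h) * x) / v x) + triangle_average K x / v x" for x
      by (simp add: S_def add_divide_distrib diff_divide_distrib)
    moreover have "c h = m * (1 + 2 * h) powr (2 - k) - 2 * (m * (1 + h) powr (2 - k)) + m"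
      by (simp add: c_def algebra_simps)
    ultimately show ?thesis by (simp only:)
  qed
  have c_lim: "((\<lambda>h. c h / h\<^sup>2) \<longlongrightarrow> m * ((2 - k) * (1 - k))) (at_right 0)"
    using tendsto_mult[OF tendsto_const tendsto_powr_second_difference[of "2 - k"], of m]
    by (simp add: c_def)
  \<comment> \<open>The factor \<open>(1 + 2 * h) powr k\<close> is the cost of starting the upper
    tent at \<open>x / (1 + 2 * h)\<close> instead of \<open>x\<close>; it tends to
    \<open>1\<close>.\<close>
  then have c_lim': "((\<lambda>h. c h / h\<^sup>2 * (1 + 2 * h) powr k) \<longlongrightarrow> m * ((2 - k) * (1 - k)) * 1) (at_right 0)"
    by (rule tendsto_mult) (rule tendsto_eq_intros refl | simp)+
  show ?thesis
  proof (rule order_tendstoI)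
    fix b assume b: "b < m * ((2 - k) * (1 - k))"
    \<comment> \<open>The step \<open>h\<close> is fixed first, close enough to \<open>0\<close> for
      \<open>c h / h^2\<close> to exceed \<open>b\<close>; only then does \<open>x\<close> tend to
      infinity.\<close>
    have "\<forall>\<^sub>F h in at_right 0. b < c h / h\<^sup>2 \<and> 0 < h"
      using order_tendstoD(1)[OF c_lim b] eventually_at_right_less by eventually_elim auto
    from eventually_happens'[OF trivial_limit_at_right_real this]
    obtain h where h: "b < c h / h\<^sup>2" "0 < h" by blast
    have "((\<lambda>x. S h x / v x / h\<^sup>2) \<longlongrightarrow> c h / h\<^sup>2) at_top"
      using S_lim[OF h(2)] h by (intro tendsto_divide tendsto_const) auto
    from order_tendstoD(1)[OF this h(1)] pos eventually_gt_at_top[of 0] eventually_ge_at_top[of a]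
    show "\<forall>\<^sub>F x in at_top. b < K x / v x"
    proof eventually_elim
      case (elim x)
      have "S h x \<le> h\<^sup>2 * K x"
        unfolding S_def by (rule triangle_average_second_difference_bounds(2)) (use h K bdd anti elim in auto)
      then have "S h x / v x / h\<^sup>2 \<le> K x / v x"
        using elim h(2) by (simp add: field_simps)
      then show ?case using elim by linarith
    qed
  next
    fix b assume b: "m * ((2 - k) * (1 - k)) < b"
    have "\<forall>\<^sub>F h in at_right 0. c h / h\<^sup>2 * (1 + 2 * h) powr k < b \<and> 0 < h"
      using order_tendstoD(2)[OF c_lim', of b] b eventually_at_right_less by (simp add: eventually_conj_iff)
    from eventually_happens'[OF trivial_limit_at_right_real this]
    obtain h where h: "c h / h\<^sup>2 * (1 + 2 * h) powr k < b" "0 < h" by blast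
    define l where "l = 1 + 2 * h"
    have l: "1 < l" using h by (simp add: l_def)
    have il: "0 < 1 / l" using l by simp
    \<comment> \<open>The starting point is chosen so that the tent over
      \<open>[?y x, l * ?y x]\<close> ends exactly at \<open>x\<close>.\<close>
    let ?y = "\<lambda>x. (1 / l) * x"
    have y_top: "filterlim ?y at_top at_top" by (rule mult_top[OF il])
    have "(1 / l) powr (- k) = l powr k" using l by (simp add: powr_divide powr_minus_divide)
    then have rvl: "((\<lambda>x. v (?y x) / v x) \<longlongrightarrow> l powr k) at_top" using rv[OF il] by simp
    have "((\<lambda>x. S h (?y x) / v (?y x) / h\<^sup>2 * (v (?y x) / v x)) \<longlongrightarrow> c h / h\<^sup>2 * l powr k) at_top"
      using h by (intro tendsto_mult tendsto_divide tendsto_const rvl filterlim_compose[OF S_lim[OF h(2)] y_top]) auto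
    from order_tendstoD(2)[OF this, of b] h(1)
    have "\<forall>\<^sub>F x in at_top. S h (?y x) / v (?y x) / h\<^sup>2 * (v (?y x) / v x) < b" by (simp add: l_def)
    from this pos eventually_compose_filterlim[OF pos y_top]
      eventually_compose_filterlim[OF eventually_gt_at_top[of 0] y_top]
      eventually_compose_filterlim[OF eventually_ge_at_top[of a] y_top]
    show "\<forall>\<^sub>F x in at_top. K x / v x < b"
    proof eventually_elim
      case (elim x)
      have "h\<^sup>2 * K ((1 + 2 * h) * ?y x) \<le> S h (?y x)"
        unfolding S_def by (rule triangle_average_second_difference_bounds(1)) (use h K bdd anti elim in auto)
      moreover have "(1 + 2 * h) * ?y x = x" using l by (simp add: l_def[symmetric])
      ultimately have "h\<^sup>2 * K x \<le> S h (?y x)" by simp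
      then have "K x / v x \<le> S h (?y x) / h\<^sup>2 / v x"
        using elim h(2) by (intro divide_right_mono) (auto simp: field_simps)
      also have "\<dots> = S h (?y x) / v (?y x) / h\<^sup>2 * (v (?y x) / v x)" using elim by simp
      finally show ?case using elim by linarith
    qed
  qed
qed

section \<open>Normalising the signs and evaluating the constant\<close>

theorem theorem6p3:
  fixes M :: "'a measure" and X :: "'a \<Rightarrow> real" and k :: real
  assumes "prob_space M"
    and "X \<in> borel_measurable M"
    and "0 < k" and "k < 2" and "k \<noteq> 1"
    and "regularly_varying_at_0 (sine_transform M X) k"
    and "eventually_monotonic (tail_difference M X)"
  shows "tail_difference M X \<sim>[at_top]
           (\<lambda>x. sine_transform M X (1 / x) / (Gamma (1 - k) * sin (pi / 2 * k)))"
proof -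
  interpret prob_space M by fact
  let ?V = "sine_transform M X" and ?K = "tail_difference M X"
  let ?C = "Gamma (1 - k) * sin (pi / 2 * k)"
  define m where "m = 1 / (Gamma (3 - k) * sin (pi / 2 * k))"
  obtain d where d: "0 < d" "\<And>t. 0 < t \<Longrightarrow> t < d \<Longrightarrow> ?V t \<noteq> 0"
    using regularly_varying_at_0_nonzero[OF assms(6)] by blast
  \<comment> \<open>A continuous function without zeros on \<open>(0, d)\<close> has constant sign
    there.\<close>
  have "\<exists>\<tau>\<in>{1, -1::real}. \<forall>t. 0 < t \<and> t < d \<longrightarrow> 0 < \<tau> * ?V t"
  proof (rule ccontr)
    assume "\<not> ?thesis"
    then obtain s t where st: "0 < s" "s < d" "?V s \<le> 0" "0 < t" "t < d" "0 \<le> ?V t"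
      by (auto simp: not_less)
    have "connected (?V ` {0<..<d})"
      by (intro connected_continuous_image continuous_on_subset[OF continuous_on_sine_transform[OF assms(2)]]) auto
    then have "0 \<in> ?V ` {0<..<d}"
      using st by (auto simp: connected_iff_interval)
    then show False using d(2) by auto
  qed
  then obtain \<tau> where \<tau>: "\<tau> = 1 \<or> \<tau> = -1" "\<And>t. 0 < t \<Longrightarrow> t < d \<Longrightarrow> 0 < \<tau> * ?V t" by blast
  obtain a \<sigma> where \<sigma>: "\<sigma> = 1 \<or> \<sigma> = (-1::real)" "antimono_on {a..} (\<lambda>u. \<sigma> * ?K u)"
  proof -
    obtain a where "mono_on {a..} ?K \<or> antimono_on {a..} ?K"
      using assms(7) unfolding eventually_monotonic_def by blast
    then show ?thesis
      using that[of 1 a] that[of "-1" a] by (auto simp: monotone_on_def)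
  qed
  have inv: "filterlim (\<lambda>x::real. 1 / x) (at_right 0) at_top" by real_asymp
  have "((\<lambda>x. \<sigma> * ?K x / (\<tau> * ?V (1 / x))) \<longlongrightarrow> (\<sigma> / \<tau> * m) * ((2 - k) * (1 - k))) at_top"
  proof (rule tendsto_of_triangle_average[where K = "\<lambda>u. \<sigma> * ?K u" and v = "\<lambda>x. \<tau> * ?V (1 / x)" and a = a])
    show "(\<lambda>u. \<sigma> * ?K u) \<in> borel_measurable borel"
      using borel_measurable_tail_difference[OF assms(2)] by measurable
    show "\<bar>\<sigma> * ?K u\<bar> \<le> 1" for u using \<sigma>(1) abs_tail_difference_le[OF assms(2)] by (auto simp: abs_mult)
    have "\<forall>\<^sub>F t in at_right 0. 0 < \<tau> * ?V t"
      using d(1) \<tau>(2) unfolding eventually_at_right_field by blast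
    from eventually_compose_filterlim[OF this inv] show "\<forall>\<^sub>F x in at_top. 0 < \<tau> * ?V (1 / x)" .
    show "((\<lambda>x. \<tau> * ?V (1 / (l * x)) / (\<tau> * ?V (1 / x))) \<longlongrightarrow> l powr (- k)) at_top" if l: "0 < l" for l
    proof -
      have "0 < 1 / l" using l by simp
      have "((\<lambda>t. ?V ((1 / l) * t) / ?V t) \<longlongrightarrow> (1 / l) powr k) (at_right 0)"
        using assms(6) \<open>0 < 1 / l\<close> unfolding regularly_varying_at_0_def by blast
      from filterlim_compose[OF this inv] show ?thesis
        using \<tau>(1) l by (auto simp: powr_divide powr_minus_divide)
    qed
    have "((\<lambda>x. \<sigma> / \<tau> * (triangle_average ?K x / ?V (1 / x))) \<longlongrightarrow> \<sigma> / \<tau> * m) at_top"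
      unfolding m_def by (intro tendsto_mult tendsto_const tendsto_triangle_average_tail_difference assms)
    moreover have "triangle_average (\<lambda>u. \<sigma> * ?K u) x = \<sigma> * triangle_average ?K x" for x
      unfolding triangle_average_def by (simp add: mult.left_commute)
    ultimately show "((\<lambda>x. triangle_average (\<lambda>u. \<sigma> * ?K u) x / (\<tau> * ?V (1 / x))) \<longlongrightarrow> \<sigma> / \<tau> * m) at_top"
      by simp
  qed (rule \<sigma>(2))
  \<comment> \<open>The signs chosen for \<open>K\<close> and \<open>V\<close> cancel in the ratio
    and leave the constant \<open>m * ((2 - k) * (1 - k))\<close> unsigned.\<close>
  from tendsto_mult[OF tendsto_const[of "\<tau> / \<sigma>"] this]
  have "((\<lambda>x. ?K x / ?V (1 / x)) \<longlongrightarrow> m * ((2 - k) * (1 - k))) at_top"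
    using \<tau>(1) \<sigma>(1) by auto
  then have lim: "((\<lambda>x. ?K x / ?V (1 / x) * ?C) \<longlongrightarrow> m * ((2 - k) * (1 - k)) * ?C) at_top"
    by (intro tendsto_mult tendsto_const)
  have "m * ((2 - k) * (1 - k)) * ?C = 1"
  proof -
    have "0 < sin (pi / 2 * k)" using assms by (intro sin_gt_zero) (auto simp: field_simps)
    moreover have G: "0 < Gamma (3 - k)" using assms by (intro Gamma_real_pos) auto
    \<comment> \<open>Two steps of the functional equation. The inequality \<open>k < 2\<close> puts
      \<open>1 - k\<close> above \<open>-1\<close>, and \<open>k \<noteq> 1\<close> keeps it off the
      pole at \<open>0\<close>.\<close>
    moreover have G_eq: "Gamma (3 - k) = (2 - k) * ((1 - k) * Gamma (1 - k))"
    proof -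
      have "2 - k \<notin> \<int>\<^sub>\<le>\<^sub>0" using assms by (auto elim!: nonpos_Ints_cases)
      moreover have "1 - k \<notin> \<int>\<^sub>\<le>\<^sub>0"
      proof
        assume "1 - k \<in> \<int>\<^sub>\<le>\<^sub>0"
        then obtain n :: int where n: "1 - k = of_int n" "n \<le> 0" by (auto elim!: nonpos_Ints_cases)
        have "- 1 < real_of_int n" "real_of_int n \<noteq> 0"
          unfolding n(1)[symmetric] using assms(4,5) by simp_all
        then show False using n(2) by simp
      qed
      ultimately show ?thesis
        using Gamma_plus1[of "2 - k"] Gamma_plus1[of "1 - k"] by (simp add: add.commute)
    qed
    moreover have "Gamma (1 - k) \<noteq> 0" using G unfolding G_eq by auto
    ultimately show ?thesis using assms(4,5) by (simp add: m_def)
  qed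
  with lim have "((\<lambda>x. ?K x / (?V (1 / x) / ?C)) \<longlongrightarrow> 1) at_top" by simp
  then show ?thesis by (rule asymp_equivI')
qed

end
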